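(* Let $A:D(A)\subset X\to X$ be a closed linear operator on a Banach space $X$, and assume that $A$ has an exponential trichotomy with exponents $0<\rho_0<\rho$, constant $\kappa$ and associated to the projectors $\Pi_s,\Pi_c,\Pi_u$. Then for each $B\in\mathcal{L}(X)$ with $\|B\|_{\mathcal{L}(X)}$ small enough, the closed linear operator $(A+B):D(A)\subset X\to X$ has an exponential trichotomy, with bounded linear projectors $\widehat{\Pi}_s,\widehat{\Pi}_c,\widehat{\Pi}_u\in\mathcal{L}(X)$ and state space decomposition $X=\widehat{X}_s\oplus\widehat{X}_c\oplus\widehat{X}_u$, where $\widehat{X}_k:=\widehat{\Pi}_k(X)$ for $k=s,c,u$, and $$\widehat{X}_c\oplus\widehat{X}_u=(I-\widehat{\Pi}_s)(X),\quad \widehat{X}_s\oplus\widehat{X}_u=(I-\widehat{\Pi}_c)(X),\quad \widehat{X}_s\oplus\widehat{X}_c=(I-\widehat{\Pi}_u)(X).$$ More precisely, let constants $\widehat{\rho}_0,\widehat{\rho}\in(0,+\infty)$ and $\widehat{\kappa}$ be given such that $0<\rho_0<\widehat{\rho}_0<\widehat{\rho}<\rho$ and $\widehat{\kappa}>\kappa$. There exists $\delta_0=\delta_0(\rho_0,\widehat{\rho}_0,\widehat{\rho},\rho,\kappa,\widehat{\kappa})\in(0,\sqrt{2}-1)$ such that for each $\delta\in\left(0,\frac{\delta_0^2}{\kappa+\delta_0}\right)$, if $\|B\|_{\mathcal{L}(X)}\le\delta$, then $A+B$ has an exponential trichotomy with exponents $\widehat{\rho}_0$ and $\widehat{\rho}$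 and with constant $\widehat{\kappa}$. Moreover the three associated projectors $\widehat{\Pi}_s,\widehat{\Pi}_c,\widehat{\Pi}_u\in\mathcal{L}(X)$ satisfy $$\|\widehat{\Pi}_k-\Pi_k\|_{\mathcal{L}(X)}<\frac{\kappa\delta}{\delta_0-\delta}\le\delta_0<\sqrt{2}-1,\quad\forall k=s,c,u,$$ and as a consequence the subspace $\widehat{X}_k=\widehat{\Pi}_k(X)$ is isomorphic to the subspace $X_k=\Pi_k(X)$. Furthermore, for each $n\in\mathbb{N}$, $$\left\|(A+B)_s^n\widehat{\Pi}_s-A_s^n\Pi_s\right\|_{\mathcal{L}(X)}\le\frac{\kappa\delta}{\delta_0-\delta}e^{-\widehat{\rho}n},\qquad \left\|(A+B)_u^{-n}\widehat{\Pi}_u-A_u^{-n}\Pi_u\right\|_{\mathcal{L}(X)}\le\frac{\kappa\delta}{\delta_0-\delta}e^{-\widehat{\rho}n},$$ and for each $n\in\mathbb{Z}$, $$\left\|(A+B)_c^n\widehat{\Pi}_c-A_c^n\Pi_c\right\|_{\mathcal{L}(X)}\le\frac{\kappa\delta}{\delta_0-\delta}e^{\widehat{\rho}_0|n|}.$$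
   Context: $\mathbb{N}=\{0,1,2,\dots\}$; $\mathcal{L}(X)$ is the space of bounded linear operators on $X$; $r(\cdot)$ is the spectral radius. For a linear operator $A:D(A)\subset X\to X$ and a subspace $Y\subset X$, the part of $A$ in $Y$ is the operator $A_Y$ with $D(A_Y)=\{x\in D(A)\cap Y: Ax\in Y\}$ and $A_Yx=Ax$. A closed linear operator $A:D(A)\subset X\to X$ has an exponential trichotomy if there exist three bounded linear projectors $\Pi_s,\Pi_c,\Pi_u\in\mathcal{L}(X)$ such that, with $X_k:=\Pi_k(X)$: $X=X_s\oplus X_c\oplus X_u$; $X_c\oplus X_u=(I-\Pi_s)(X)$, $X_s\oplus X_u=(I-\Pi_c)(X)$, $X_s\oplus X_c=(I-\Pi_u)(X)$; $D(A)=X_s\oplus X_c\oplus(D(A)\cap X_u)$; $A(D(A)\cap X_k)\subset X_k$ for $k=s,c,u$; and there is $\alpha\in(0,1)$ such that, $A_k$ denoting the part of $A$ in $X_k$: $A_s\in\mathcal{L}(X_s)$ with $r(A_s)\le\alpha$; $A_u:D(A_u)\subset X_u\to X_u$ is invertible (with inverse in $\mathcal{L}(X_u)$) and $r(A_u^{-1})\le\alpha$; $A_c\in\mathcal{L}(X_c)$ is invertible with $r(A_c)<\alpha^{-1}$ and $r(A_c^{-1})<\alpha^{-1}$. The last (spectral radius) conditions are equivalent to the existence of constants $\kappa\ge1$ and $0<\rho_0<\rho$ such that: $\|A_c^n\|_{\mathcal{L}(X_c)}\le\kappa e^{\rho_0|n|}$ for all $n\in\mathbb{Z}$; $\|A_s^n\|_{\mathcal{L}(X_s)}\le\kappa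 e^{-\rho n}$ for all $n\in\mathbb{N}$; and $0$ belongs to the resolvent set of $A_u$ with $\|A_u^{-n}\|_{\mathcal{L}(X_u)}\le\kappa e^{-\rho n}$ for all $n\in\mathbb{N}$. When these estimates hold, the trichotomy is said to have exponents $\rho_0<\rho$, constant $\kappa$ and to be associated to the projectors $\Pi_s,\Pi_c,\Pi_u$. $(A+B)_k$ denotes the part of $A+B$ in $\widehat{X}_k$.
   Formalization: δ0 may depend also on a bound M for the norms of Π_s, Π_c, Π_u (with the six constants alone the claim fails: 2×2 matrices with nearly parallel X_s, X_u), and on the space X, which is a real Banach space fixed before δ0. *)

theory Defs
  imports "HOL-Analysis.Analysis"
begin

text \<open>
  A linear operator \<open>T : D(T) \<subseteq> X \<rightarrow> X\<close> is a pair of its domain and a function. The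
  function is total only because HOL functions are: its values outside the domain are never used.
\<close>

type_synonym 'a operator = "'a set \<times> ('a \<Rightarrow> 'a)"

definition linear_operator :: "'a::real_vector operator \<Rightarrow> bool" where
  "linear_operator T \<longleftrightarrow>
     subspace (fst T) \<and>
     (\<forall>x\<in>fst T. \<forall>y\<in>fst T. snd T (x + y) = snd T x + snd T y) \<and>
     (\<forall>c. \<forall>x\<in>fst T. snd T (c *\<^sub>R x) = c *\<^sub>R snd T x)"

definition closed_operator :: "'a::real_normed_vector operator \<Rightarrow> bool" where
  "closed_operator T \<longleftrightarrow> linear_operator T \<and> closed {(x, snd T x) | x. x \<in> fst T}"

definition add_bounded ::
  "'a::real_normed_vector operator \<Rightarrow> ('a \<Rightarrow>\<^sub>L 'a) \<Rightarrow> 'a operator" where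
  "add_bounded T B = (fst T, \<lambda>x. snd T x + blinfun_apply B x)"

definition part :: "'a operator \<Rightarrow> 'a set \<Rightarrow> 'a operator" where
  "part T Y = ({x \<in> fst T \<inter> Y. snd T x \<in> Y}, snd T)"

text \<open>\<open>T \<in> \<L>(Y)\<close> for a subspace \<open>Y\<close>.\<close>

definition bounded_operator_on :: "'a::real_normed_vector set \<Rightarrow> 'a operator \<Rightarrow> bool" where
  "bounded_operator_on Y T \<longleftrightarrow>
     fst T = Y \<and> snd T ` Y \<subseteq> Y \<and> linear_operator T \<and>
     (\<exists>K. \<forall>x\<in>Y. norm (snd T x) \<le> K * norm x)"

definition inverse_operator :: "'a operator \<Rightarrow> 'a operator" where
  "inverse_operator T = (snd T ` fst T, inv_into (fst T) (snd T))"

text \<open>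
  \<open>T : D(T) \<subseteq> Y \<rightarrow> Y\<close> is invertible with inverse in \<open>\<L>(Y)\<close>; surjectivity onto \<open>Y\<close> is the
  requirement that the domain of the inverse operator is \<open>Y\<close>.
\<close>

definition invertible_operator_on :: "'a::real_normed_vector set \<Rightarrow> 'a operator \<Rightarrow> bool" where
  "invertible_operator_on Y T \<longleftrightarrow>
     inj_on (snd T) (fst T) \<and> bounded_operator_on Y (inverse_operator T)"

text \<open>
  Integer powers, \<open>T\<^sup>-\<^sup>n = (T\<^sup>-\<^sup>1)\<^sup>n\<close>. Below they are only taken of operators for which the iterated
  map sends a subspace into itself, so that no value outside a domain enters.
\<close>

definition opow :: "'a operator \<Rightarrow> int \<Rightarrow> 'a \<Rightarrow> 'a" where
  "opow T n = (if 0 \<le> n then snd T ^^ nat n else snd (inverse_operator T) ^^ nat (- n))"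

text \<open>
  The norm of \<open>\<L>(Y)\<close>; it is \<^const>\<open>onorm\<close> if \<open>Y\<close> is the whole space. As a supremum of reals it is
  meaningful only for maps that are bounded on \<open>Y\<close>.
\<close>

definition onorm_on ::
  "'a::real_normed_vector set \<Rightarrow> ('a \<Rightarrow> 'b::real_normed_vector) \<Rightarrow> real" where
  "onorm_on Y f = (SUP x\<in>Y. norm (f x) / norm x)"

text \<open>
  The spectral radius of \<open>T \<in> \<L>(Y)\<close>, as the limit in Gelfand's formula. The scalars are real, so
  the supremum of \<open>\<bar>\<lambda>\<bar>\<close> over the real spectrum would be wrong (a plane rotation has none).
\<close>

definition spectral_radius :: "'a::real_normed_vector set \<Rightarrow> 'a operator \<Rightarrow> real" where
  "spectral_radius Y T = lim (\<lambda>n. root n (onorm_on Y (opow T (int n))))"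

definition direct_sum2 :: "'a::real_vector set \<Rightarrow> 'a set \<Rightarrow> 'a set \<Rightarrow> bool" where
  "direct_sum2 Z U V \<longleftrightarrow> Z = {u + v | u v. u \<in> U \<and> v \<in> V} \<and> U \<inter> V = {0}"

definition direct_sum3 :: "'a::real_vector set \<Rightarrow> 'a set \<Rightarrow> 'a set \<Rightarrow> 'a set \<Rightarrow> bool" where
  "direct_sum3 Z U V W \<longleftrightarrow>
     Z = {u + v + w | u v w. u \<in> U \<and> v \<in> V \<and> w \<in> W} \<and>
     (\<forall>u\<in>U. \<forall>v\<in>V. \<forall>w\<in>W. u + v + w = 0 \<longrightarrow> u = 0 \<and> v = 0 \<and> w = 0)"

definition projector :: "('a::real_normed_vector \<Rightarrow>\<^sub>L 'a) \<Rightarrow> bool" where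
  "projector P \<longleftrightarrow> P o\<^sub>L P = P"

abbreviation rg :: "('a::real_normed_vector \<Rightarrow>\<^sub>L 'a) \<Rightarrow> 'a set" where
  "rg P \<equiv> range (blinfun_apply P)"

text \<open>
  The conditions of a trichotomy that do not involve growth rates: the state space decomposition,
  the invariance, and \<open>A\<^sub>s \<in> \<L>(X\<^sub>s)\<close>, \<open>A\<^sub>c \<in> \<L>(X\<^sub>c)\<close> invertible, \<open>A\<^sub>u\<close> invertible.
\<close>

definition trichotomy_splitting ::
  "'a::real_normed_vector operator \<Rightarrow> ('a \<Rightarrow>\<^sub>L 'a) \<Rightarrow> ('a \<Rightarrow>\<^sub>L 'a) \<Rightarrow> ('a \<Rightarrow>\<^sub>L 'a) \<Rightarrow> bool" where
  "trichotomy_splitting A Ps Pc Pu \<longleftrightarrow>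
     projector Ps \<and> projector Pc \<and> projector Pu \<and>
     direct_sum3 UNIV (rg Ps) (rg Pc) (rg Pu) \<and>
     direct_sum2 (rg (id_blinfun - Ps)) (rg Pc) (rg Pu) \<and>
     direct_sum2 (rg (id_blinfun - Pc)) (rg Ps) (rg Pu) \<and>
     direct_sum2 (rg (id_blinfun - Pu)) (rg Ps) (rg Pc) \<and>
     direct_sum3 (fst A) (rg Ps) (rg Pc) (fst A \<inter> rg Pu) \<and>
     snd A ` (fst A \<inter> rg Ps) \<subseteq> rg Ps \<and>
     snd A ` (fst A \<inter> rg Pc) \<subseteq> rg Pc \<and>
     snd A ` (fst A \<inter> rg Pu) \<subseteq> rg Pu \<and>
     bounded_operator_on (rg Ps) (part A (rg Ps)) \<and>
     bounded_operator_on (rg Pc) (part A (rg Pc)) \<and>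
     invertible_operator_on (rg Pc) (part A (rg Pc)) \<and>
     invertible_operator_on (rg Pu) (part A (rg Pu))"

definition exponential_trichotomy ::
  "'a::real_normed_vector operator \<Rightarrow> ('a \<Rightarrow>\<^sub>L 'a) \<Rightarrow> ('a \<Rightarrow>\<^sub>L 'a) \<Rightarrow> ('a \<Rightarrow>\<^sub>L 'a) \<Rightarrow> bool" where
  "exponential_trichotomy A Ps Pc Pu \<longleftrightarrow>
     trichotomy_splitting A Ps Pc Pu \<and>
     (\<exists>\<alpha>. 0 < \<alpha> \<and> \<alpha> < 1 \<and>
        spectral_radius (rg Ps) (part A (rg Ps)) \<le> \<alpha> \<and>
        spectral_radius (rg Pu) (inverse_operator (part A (rg Pu))) \<le> \<alpha> \<and>
        spectral_radius (rg Pc) (part A (rg Pc)) < inverse \<alpha> \<and>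
        spectral_radius (rg Pc) (inverse_operator (part A (rg Pc))) < inverse \<alpha>)"

text \<open>
  The trichotomy with exponents \<open>\<rho>0 < \<rho>\<close> and constant \<open>\<kappa>\<close>. The norms are those of \<open>\<L>(X\<^sub>k)\<close>, so
  \<open>\<kappa>\<close> does not bound the norms of the projectors.
\<close>

definition exponential_trichotomy_with ::
  "'a::real_normed_vector operator \<Rightarrow> real \<Rightarrow> real \<Rightarrow> real \<Rightarrow>
   ('a \<Rightarrow>\<^sub>L 'a) \<Rightarrow> ('a \<Rightarrow>\<^sub>L 'a) \<Rightarrow> ('a \<Rightarrow>\<^sub>L 'a) \<Rightarrow> bool" where
  "exponential_trichotomy_with A \<rho>0 \<rho> \<kappa> Ps Pc Pu \<longleftrightarrow>
     0 < \<rho>0 \<and> \<rho>0 < \<rho> \<and> 1 \<le> \<kappa> \<and>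
     trichotomy_splitting A Ps Pc Pu \<and>
     (\<forall>n::int. onorm_on (rg Pc) (opow (part A (rg Pc)) n) \<le> \<kappa> * exp (\<rho>0 * real_of_int \<bar>n\<bar>)) \<and>
     (\<forall>n::nat. onorm_on (rg Ps) (opow (part A (rg Ps)) (int n)) \<le> \<kappa> * exp (- \<rho> * real n)) \<and>
     (\<forall>n::nat. onorm_on (rg Pu) (opow (part A (rg Pu)) (- int n)) \<le> \<kappa> * exp (- \<rho> * real n))"

text \<open>Isomorphism of normed spaces: a linear bijection that is bounded in both directions.\<close>

definition isomorphic_subspaces ::
  "'a::real_normed_vector set \<Rightarrow> 'a set \<Rightarrow> bool" where
  "isomorphic_subspaces U V \<longleftrightarrow>
     (\<exists>T. linear_operator (U, T) \<and> bij_betw T U V \<and>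
          (\<exists>K. \<forall>x\<in>U. norm (T x) \<le> K * norm x) \<and>
          (\<exists>K. \<forall>y\<in>V. norm (inv_into U T y) \<le> K * norm y))"

end

theory Submission
  imports Defs
begin

text \<open>
  A trichotomy is encoded by two sequences of bounded operators on \<open>X\<close> indexed by the integers,
  the Green kernels of the two dichotomies that it contains: stable against centre-unstable
  (\<open>Gs\<close>) and centre-stable against unstable (\<open>Gu\<close>). A Green kernel \<open>G\<close> of \<open>T\<close> is the
  operator-valued solution of \<open>G (n + 1) = T (G n) + [n = 0] I\<close> that does not grow too fast in either
  direction; for \<open>Gs\<close> it is \<open>A\<^sub>s^(n - 1) \<Pi>\<^sub>s\<close> when \<open>n \<ge> 1\<close> and
  \<open>- A\<^sub>c^(n - 1) \<Pi>\<^sub>c - A\<^sub>u^(n - 1) \<Pi>\<^sub>u\<close> when \<open>n \<le> 0\<close>. Only bounded operators occur in it, even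
  though \<open>A\<close> is unbounded, and bounded solutions of \<open>u (n + 1) = T (u n) + f n\<close> are given by the
  convolution of \<open>G\<close> and \<open>f\<close>.

  Perturbing \<open>A\<close> by \<open>B\<close> turns the equation for the kernel into the fixed point equation
  \<open>H = G + G * (B H)\<close>. Convolution with a kernel of exponents \<open>(\<rho>, \<rho>0)\<close> is bounded on the
  sequences of order \<open>min(e^(-\<rho>' n), e^(-\<rho>0' n))\<close> when \<open>\<rho>0 < \<rho>0' < \<rho>' < \<rho>\<close>
  (\<open>wt_convolution\<close>), so for small \<open>B\<close> this is a contraction: \<open>H\<close> exists, and \<open>H - G\<close> is of size
  \<open>\<parallel>B\<parallel>\<close> in that weighted norm (\<open>perturbed_kernel_exists\<close>). The same contraction shows that
  \<open>A + B\<close> has no nonzero homogeneous solution in this growth class (\<open>perturbed_uniqueness\<close>).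

  Everything else is uniqueness. Truncating \<open>H\<close> to \<open>n \<ge> 1\<close> gives a solution with source
  \<open>H 1\<close> at \<open>0\<close>, hence \<open>H n H 1 = H n\<close> for \<open>n \<ge> 1\<close> and \<open>H n H 1 = 0\<close> for \<open>n \<le> 0\<close>; in
  particular \<open>H 1\<close> is a projector. Comparing truncations of the two perturbed kernels gives all mixed
  products, so \<open>Qs = Hs 1\<close>, \<open>Qu = I - Hu 1\<close> and \<open>Qc = Hu 1 - Hs 1\<close> are complementary projectors that
  commute with \<open>A + B\<close>, the operators \<open>Hu 0 - Hs 0\<close> and \<open>- Hu 0\<close> invert \<open>A + B\<close> on the centre and
  the unstable space, and the powers of the three parts are values of the kernels (locale
  \<open>green_kernel_pair\<close>). The estimates on projectors and powers are then estimates on \<open>H - G\<close>, with a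
  bound proportional to \<open>\<parallel>B\<parallel>\<close> (\<open>trichotomy_perturbation\<close>); choosing \<open>\<delta>0\<close> small turns that bound
  into \<open>\<kappa> \<delta> / (\<delta>0 - \<delta>)\<close>, as the latter is at least \<open>\<kappa> \<delta> / \<delta>0\<close>.
\<close>

section \<open>Two-sided exponential weights and their convolution\<close>

text \<open>
  The growth class of a Green kernel. For \<open>b \<le> a\<close> the weight is \<open>e^(-a n)\<close> to the right of \<open>0\<close> and
  \<open>e^(-b n)\<close> to the left of it. Negative exponents are allowed: the kernel of the splitting
  centre-stable against unstable lives in \<open>wt (-\<rho>0) (-\<rho>)\<close>.
\<close>

definition wt :: "real \<Rightarrow> real \<Rightarrow> int \<Rightarrow> real" where
  "wt a b n = min (exp (- a * n)) (exp (- b * n))"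

lemma wt_pos [simp]: "0 < wt a b n"
  by (simp add: wt_def)

lemma wt_nonneg [simp]: "0 \<le> wt a b n"
  using wt_pos[of a b n] by linarith

lemma wt_0 [simp]: "wt a b 0 = 1"
  by (simp add: wt_def)

lemma wt_of_nonneg: "b \<le> a \<Longrightarrow> 0 \<le> n \<Longrightarrow> wt a b n = exp (- a * n)"
  by (simp add: wt_def min_def mult_right_mono)

lemma wt_of_nonpos: "b \<le> a \<Longrightarrow> n \<le> 0 \<Longrightarrow> wt a b n = exp (- b * n)"
  using mult_right_mono_neg[of b a n] by (simp add: wt_def)

lemma wt_le1: "wt a b n \<le> exp (- a * n)" and wt_le2: "wt a b n \<le> exp (- b * n)"
  by (simp_all add: wt_def)

lemma wt_Suc_le:
  assumes "b \<le> a"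
  shows "wt a b (n + 1) \<le> exp (- b) * wt a b n"
proof -
  have "exp (- a * real_of_int (n + 1)) \<le> exp (- b) * exp (- a * n)"
    using assms by (simp add: exp_add[symmetric] algebra_simps)
  moreover have "exp (- b * real_of_int (n + 1)) = exp (- b) * exp (- b * n)"
    by (simp add: exp_add[symmetric] algebra_simps)
  ultimately show ?thesis
    unfolding wt_def by (simp add: min_mult_distrib_left min.coboundedI1)
qed

lemma wt_mono: "n \<ge> 0 \<Longrightarrow> a' \<le> a \<Longrightarrow> b' \<le> a \<Longrightarrow> wt a b n \<le> wt a' b' n"
  using wt_le1[of a b n] mult_right_mono[of a' a n] mult_right_mono[of b' a n]
  by (simp add: wt_def min.coboundedI1)

lemma wt_mono_nonpos: "n \<le> 0 \<Longrightarrow> b \<le> a' \<Longrightarrow> b \<le> b' \<Longrightarrow> wt a b n \<le> wt a' b' n"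
  using wt_le2[of a b n] mult_right_mono_neg[of b a' n] mult_right_mono_neg[of b b' n]
  by (simp add: wt_def min.coboundedI2)

lemma summable_on_geometric_int:
  fixes r :: real
  assumes "0 \<le> r" "r < 1"
  shows "(\<lambda>m::int. r ^ nat \<bar>m\<bar>) summable_on UNIV"
proof -
  have nat: "(\<lambda>n::nat. r ^ n) summable_on UNIV"
    using assms by (intro norm_summable_imp_summable_on) (simp add: norm_power summable_geometric)
  have "(\<lambda>m::int. r ^ nat \<bar>m\<bar>) summable_on (range int)"
    using nat by (subst summable_on_reindex) (auto simp: o_def)
  moreover have "(\<lambda>m::int. r ^ nat \<bar>m\<bar>) summable_on (range (\<lambda>n. - int n))"
    using nat by (subst summable_on_reindex) (auto simp: o_def inj_on_def)
  ultimately have "(\<lambda>m::int. r ^ nat \<bar>m\<bar>) summable_on (range int \<union> range (\<lambda>n. - int n))"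
    by (rule summable_on_union)
  also have "range int \<union> range (\<lambda>n. - int n) = UNIV"
    by (metis (no_types, lifting) UNIV_eq_I UnI1 UnI2 int_cases2 rangeI)
  finally show ?thesis .
qed

lemma summable_on_exp_wt:
  fixes \<gamma> :: real
  assumes "b < \<gamma>" "\<gamma> < a"
  shows "(\<lambda>m::int. exp (\<gamma> * real_of_int m) * wt a b m) summable_on UNIV"
proof (rule summable_on_comparison_test[OF summable_on_geometric_int])
  define c where "c = min (a - \<gamma>) (\<gamma> - b)"
  have "c > 0" using assms by (simp add: c_def)
  then show "exp (- c) < 1" by simp
  fix m :: int
  have pw: "exp (- c) ^ nat \<bar>m\<bar> = exp (- c * \<bar>m\<bar>)"
    by (simp add: exp_of_nat_mult[symmetric] mult.commute)
  show "exp (\<gamma> * real_of_int m) * wt a b m \<le> exp (- c) ^ nat \<bar>m\<bar>"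
  proof (cases "m \<ge> 0")
    case True
    have "exp (\<gamma> * real_of_int m) * wt a b m \<le> exp (\<gamma> * real_of_int m) * exp (- a * real_of_int m)"
      by (intro mult_left_mono wt_le1) auto
    also have "\<dots> = exp (- (a - \<gamma>) * real_of_int m)"
      by (simp add: exp_add[symmetric] algebra_simps)
    also have "\<dots> \<le> exp (- c * real_of_int m)"
      using True by (simp add: c_def mult_right_mono del: minus_diff_eq)
    finally show ?thesis using True pw by simp
  next
    case False
    have "exp (\<gamma> * real_of_int m) * wt a b m \<le> exp (\<gamma> * real_of_int m) * exp (- b * real_of_int m)"
      by (intro mult_left_mono wt_le2) auto
    also have "\<dots> = exp (- (\<gamma> - b) * \<bar>m\<bar>)"
      using False by (simp add: exp_add[symmetric] algebra_simps)
    also have "\<dots> \<le> exp (- c * \<bar>m\<bar>)"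
      unfolding exp_le_cancel_iff by (intro mult_right_mono) (auto simp: c_def)
    finally show ?thesis using pw by simp
  qed
qed auto

text \<open>
  A bound for the convolution with \<open>wt a b\<close> on sequences of order \<open>wt a' b'\<close>: the two series are the
  operator norms with respect to the pure exponentials \<open>e^(-a' n)\<close> and \<open>e^(-b' n)\<close>.
\<close>

definition wt_conv :: "real \<Rightarrow> real \<Rightarrow> real \<Rightarrow> real \<Rightarrow> real" where
  "wt_conv a b a' b' =
     (\<Sum>\<^sub>\<infinity>m. exp (a' * real_of_int m) * wt a b m) + (\<Sum>\<^sub>\<infinity>m. exp (b' * real_of_int m) * wt a b m)"

lemma wt_conv_nonneg: "0 \<le> wt_conv a b a' b'"
  unfolding wt_conv_def by (intro add_nonneg_nonneg infsum_nonneg) auto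

text \<open>
  The minimum \<open>wt a' b'\<close> is below both pure exponentials, and for each \<open>\<gamma> \<in> {a', b'}\<close> the convolution
  with \<open>e^(-\<gamma> n)\<close> reproduces this exponential up to the factor \<open>\<Sum> e^(\<gamma> m) wt a b m\<close>, which is
  finite because \<open>b < \<gamma> < a\<close>.
\<close>

lemma wt_convolution:
  assumes "b < b'" "b' < a'" "a' < a"
  shows "(\<lambda>k. wt a b (n - k) * wt a' b' k) summable_on UNIV"
    and "(\<Sum>\<^sub>\<infinity>k. wt a b (n - k) * wt a' b' k) \<le> wt_conv a b a' b' * wt a' b' n"
proof -
  define f where "f = (\<lambda>k. wt a b (n - k) * wt a' b' k)"
  have one: "f summable_on UNIV \<and> infsum f UNIV \<le> wt_conv a b a' b' * exp (- \<gamma> * n)"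
    if \<gamma>: "b < \<gamma>" "\<gamma> < a" and le: "\<And>k. wt a' b' k \<le> exp (- \<gamma> * k)"
      and S: "(\<Sum>\<^sub>\<infinity>m. exp (\<gamma> * real_of_int m) * wt a b m) \<le> wt_conv a b a' b'" for \<gamma> :: real
  proof -
    define g where "g = (\<lambda>m::int. exp (\<gamma> * real_of_int m) * wt a b m)"
    have g: "(g has_sum infsum g UNIV) UNIV"
      using summable_on_exp_wt[OF \<gamma>] by (simp add: g_def)
    have bij: "bij (\<lambda>k::int. n - k)"
      by (rule bij_betw_byWitness[where f' = "\<lambda>k. n - k"]) auto
    have "((\<lambda>k. g (n - k)) has_sum infsum g UNIV) UNIV"
      using has_sum_reindex_bij_betw[OF bij, of g "infsum g UNIV"] g by simp
    then have h: "((\<lambda>k. exp (- \<gamma> * n) * g (n - k)) has_sum exp (- \<gamma> * n) * infsum g UNIV) UNIV"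
      by (rule has_sum_cmult_right)
    have fle: "f k \<le> exp (- \<gamma> * n) * g (n - k)" for k
    proof -
      have "f k \<le> wt a b (n - k) * exp (- \<gamma> * k)"
        unfolding f_def by (intro mult_left_mono le) auto
      also have "\<dots> = exp (- \<gamma> * n) * g (n - k)"
        by (simp add: g_def exp_add[symmetric] exp_diff exp_minus field_simps)
      finally show ?thesis .
    qed
    have sf: "f summable_on UNIV"
      by (rule summable_on_comparison_test[OF has_sum_imp_summable[OF h]])
         (use fle in \<open>auto simp: f_def\<close>)
    have "infsum f UNIV \<le> exp (- \<gamma> * n) * infsum g UNIV"
      using infsum_mono[OF sf has_sum_imp_summable[OF h] fle] infsumI[OF h] by simp
    also have "\<dots> \<le> exp (- \<gamma> * n) * wt_conv a b a' b'"
      using S by (simp add: g_def)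
    finally show ?thesis using sf by (simp add: mult.commute)
  qed
  have pos: "0 \<le> (\<Sum>\<^sub>\<infinity>m. exp (\<gamma> * real_of_int m) * wt a b m)" for \<gamma>
    by (intro infsum_nonneg) auto
  have "f summable_on UNIV \<and> infsum f UNIV \<le> wt_conv a b a' b' * exp (- a' * n)"
    by (rule one) (use assms wt_le1[of a' b'] pos[of b'] in \<open>auto simp: wt_conv_def\<close>)
  moreover have "f summable_on UNIV \<and> infsum f UNIV \<le> wt_conv a b a' b' * exp (- b' * n)"
    by (rule one) (use assms wt_le2[of a' b'] pos[of a'] in \<open>auto simp: wt_conv_def\<close>)
  ultimately show "(\<lambda>k. wt a b (n - k) * wt a' b' k) summable_on UNIV"
    and "(\<Sum>\<^sub>\<infinity>k. wt a b (n - k) * wt a' b' k) \<le> wt_conv a b a' b' * wt a' b' n"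
    unfolding f_def by (auto simp: wt_def min_def)
qed

section \<open>Green kernels and inhomogeneous solutions\<close>

text \<open>
  The equation \<open>G (n + 1) = T (G n) + [n = 0] I\<close> and, on the domain of \<open>T\<close>, the same equation with
  \<open>T\<close> acting from the right. The left equation gives solutions of the inhomogeneous problem,
  the right one gives their uniqueness.
\<close>

definition green_left ::
  "'a::real_normed_vector operator \<Rightarrow> (int \<Rightarrow> 'a \<Rightarrow>\<^sub>L 'a) \<Rightarrow> bool" where
  "green_left T G \<longleftrightarrow>
     (\<forall>n x. G n x \<in> fst T \<and> G (n + 1) x = snd T (G n x) + (if n = 0 then x else 0))"

definition green_right ::
  "'a::real_normed_vector operator \<Rightarrow> (int \<Rightarrow> 'a \<Rightarrow>\<^sub>L 'a) \<Rightarrow> bool" where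
  "green_right T G \<longleftrightarrow>
     (\<forall>n. \<forall>x\<in>fst T. G (n + 1) x = G n (snd T x) + (if n = 0 then x else 0))"

lemma norm_le_mult_imp_nonneg:
  fixes c :: real
  assumes "norm x \<le> c * w" "0 < w"
  shows "0 \<le> c"
  using order.trans[OF norm_ge_zero assms(1)] mult_neg_pos[of c w] assms(2) by linarith

lemma has_sum_subtract:
  fixes f g :: "'b \<Rightarrow> 'c::real_normed_vector"
  assumes "(f has_sum s) A" "(g has_sum t) A"
  shows "((\<lambda>x. f x - g x) has_sum (s - t)) A"
  using has_sum_add[OF assms(1), of "\<lambda>x. - g x" "- t"] assms(2) by (simp add: has_sum_uminus)

lemma has_sum_delta: "((\<lambda>k. if k = n then y else 0) has_sum y) UNIV"
  by (rule has_sum_finite_neutralI[of "{n}"]) auto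

lemma linear_operatorD:
  assumes "linear_operator T"
  shows "subspace (fst T)"
    and "x \<in> fst T \<Longrightarrow> y \<in> fst T \<Longrightarrow> snd T (x + y) = snd T x + snd T y"
    and "x \<in> fst T \<Longrightarrow> snd T (c *\<^sub>R x) = c *\<^sub>R snd T x"
    and "snd T 0 = 0"
    and "x \<in> fst T \<Longrightarrow> snd T (- x) = - snd T x"
    and "x \<in> fst T \<Longrightarrow> y \<in> fst T \<Longrightarrow> snd T (x - y) = snd T x - snd T y"
proof -
  show sub: "subspace (fst T)"
    using assms by (auto simp: linear_operator_def)
  show add: "x \<in> fst T \<Longrightarrow> y \<in> fst T \<Longrightarrow> snd T (x + y) = snd T x + snd T y" for x y
    using assms by (auto simp: linear_operator_def)
  show scale: "x \<in> fst T \<Longrightarrow> snd T (c *\<^sub>R x) = c *\<^sub>R snd T x" for x c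
    using assms by (auto simp: linear_operator_def)
  show "snd T 0 = 0"
    using scale[OF subspace_0[OF sub], of 0] by simp
  show neg: "x \<in> fst T \<Longrightarrow> snd T (- x) = - snd T x" for x
    using scale[of x "-1"] by simp
  show "x \<in> fst T \<Longrightarrow> y \<in> fst T \<Longrightarrow> snd T (x - y) = snd T x - snd T y"
    using add[of x "- y"] neg[of y] subspace_neg[OF sub, of y] by simp
qed

text \<open>
  This is where closedness enters: it lets an unbounded \<open>T\<close> be applied under an infinite sum, by passing
  to the limit along the finite partial sums in the graph.
\<close>

lemma closed_operator_has_sum:
  assumes "closed_operator T" and dom: "\<And>k. g k \<in> fst T"
    and s: "(g has_sum s) UNIV" and t: "((\<lambda>k. snd T (g k)) has_sum t) UNIV"
  shows "s \<in> fst T" "snd T s = t"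
proof -
  have lin: "linear_operator T" and cl: "closed {(x, snd T x) | x. x \<in> fst T}"
    using assms(1) by (auto simp: closed_operator_def)
  have fin: "sum g F \<in> fst T \<and> (\<Sum>k\<in>F. snd T (g k)) = snd T (sum g F)" if "finite F" for F
    using that
  proof (induction F)
    case empty
    show ?case using linear_operatorD(1,4)[OF lin] by (simp add: subspace_0)
  next
    case (insert k F)
    then show ?case
      using linear_operatorD(1,2)[OF lin] dom by (simp add: subspace_add)
  qed
  have "((\<lambda>F. (sum g F, \<Sum>k\<in>F. snd T (g k))) \<longlongrightarrow> (s, t)) (finite_subsets_at_top UNIV)"
    using s t unfolding has_sum_def by (rule tendsto_Pair)
  then have "(s, t) \<in> {(x, snd T x) | x. x \<in> fst T}"
  proof (rule Lim_in_closed_set[OF cl _ finite_subsets_at_top_neq_bot, rotated])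
    show "\<forall>\<^sub>F F in finite_subsets_at_top UNIV.
      (sum g F, \<Sum>k\<in>F. snd T (g k)) \<in> {(x, snd T x) | x. x \<in> fst T}"
      by (rule eventually_finite_subsets_at_top_weakI) (use fin in auto)
  qed
  then show "s \<in> fst T" "snd T s = t" by auto
qed

lemma summable_on_kernel:
  fixes f :: "int \<Rightarrow> 'b::banach"
  assumes exps: "b < b'" "b' < a'" "a' < a"
    and f: "\<And>k. norm (f k) \<le> c * (wt a b (n - k) * wt a' b' k)"
  shows "f summable_on UNIV" "norm (infsum f UNIV) \<le> c * (wt_conv a b a' b' * wt a' b' n)"
proof -
  have c: "0 \<le> c"
    by (rule norm_le_mult_imp_nonneg[OF f[of 0]]) simp
  have g: "(\<lambda>k. c * (wt a b (n - k) * wt a' b' k)) summable_on UNIV"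
    using wt_convolution(1)[OF exps] by (rule summable_on_cmult_right)
  have nf: "(\<lambda>k. norm (f k)) summable_on UNIV"
    by (rule summable_on_comparison_test[OF g]) (use f in auto)
  then show "f summable_on UNIV" by (rule abs_summable_summable)
  have "norm (infsum f UNIV) \<le> (\<Sum>\<^sub>\<infinity>k. norm (f k))"
    by (rule norm_infsum_bound[OF nf])
  also have "\<dots> \<le> (\<Sum>\<^sub>\<infinity>k. c * (wt a b (n - k) * wt a' b' k))"
    by (rule infsum_mono[OF nf g f])
  also have "\<dots> = c * (\<Sum>\<^sub>\<infinity>k. wt a b (n - k) * wt a' b' k)"
    by (rule infsum_cmult_right')
  also have "\<dots> \<le> c * (wt_conv a b a' b' * wt a' b' n)"
    by (rule mult_left_mono[OF wt_convolution(2)[OF exps] c])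
  finally show "norm (infsum f UNIV) \<le> c * (wt_conv a b a' b' * wt a' b' n)" .
qed

text \<open>
  Inserting \<open>f k = u (k + 1) - T (u k)\<close> and the right equation, the \<open>k\<close>-th term of the convolution is
  \<open>g (k + 1) - g k\<close> with \<open>g k = G (n - k + 1) (u k)\<close>, plus \<open>u n\<close> at \<open>k = n\<close>. As \<open>g\<close> is
  summable over all integers, a shift of the index cancels the first two contributions.
\<close>

lemma green_representation:
  fixes T :: "'a::banach operator"
  assumes exps: "b < b'" "b' < a'" "a' < a"
    and right: "green_right T G" and G: "\<And>n. norm (G n) \<le> C * wt a b n"
    and u: "\<And>n. u n \<in> fst T" "\<And>n. u (n + 1) = snd T (u n) + f n"
    and bd: "\<And>n. norm (u n) \<le> K * wt a' b' n"
  shows "((\<lambda>k. G (n - k) (f k)) has_sum u n) UNIV"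
proof -
  define g where "g = (\<lambda>k. G (n - k + 1) (u k))"
  have C: "0 \<le> C"
    by (rule norm_le_mult_imp_nonneg[OF G[of 0]]) simp
  have "norm (g k) \<le> (C * K) * (wt a b ((n + 1) - k) * wt a' b' k)" for k
  proof -
    have "norm (g k) \<le> norm (G (n - k + 1)) * norm (u k)"
      unfolding g_def by (rule norm_blinfun)
    also have "\<dots> \<le> (C * wt a b (n - k + 1)) * (K * wt a' b' k)"
      by (intro mult_mono G bd) (use C in auto)
    finally show ?thesis by (simp add: algebra_simps)
  qed
  from summable_on_kernel(1)[OF exps this] obtain S where S: "(g has_sum S) UNIV"
    by (auto simp: summable_on_def)
  have bij: "bij (\<lambda>k::int. k + 1)"
    by (rule bij_betw_byWitness[where f' = "\<lambda>k. k - 1"]) auto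
  have S': "((\<lambda>k. g (k + 1)) has_sum S) UNIV"
    using has_sum_reindex_bij_betw[OF bij, of g S] S by simp
  have "((\<lambda>k. g (k + 1) - g k + (if k = n then u n else 0)) has_sum (S - S + u n)) UNIV"
    by (intro has_sum_add has_sum_subtract S S' has_sum_delta)
  moreover have "g (k + 1) - g k + (if k = n then u n else 0) = G (n - k) (f k)" for k
  proof -
    have "g k = G (n - k) (snd T (u k)) + (if n - k = 0 then u k else 0)"
      unfolding g_def using right u(1) by (simp add: green_right_def)
    then show ?thesis by (auto simp: g_def u(2) blinfun.add_right)
  qed
  ultimately show ?thesis by simp
qed

text \<open>
  A homogeneous solution of \<open>T + B\<close> solves the problem for \<open>T\<close> with source \<open>B (u n)\<close>, so by
  \<open>green_representation\<close> it is reproduced by the contraction \<open>u \<mapsto> G * (B u)\<close>; iterating the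
  estimate shows that it vanishes.
\<close>

lemma perturbed_uniqueness:
  fixes T :: "'a::banach operator"
  assumes exps: "b < b'" "b' < a'" "a' < a"
    and right: "green_right T G" and G: "\<And>n. norm (G n) \<le> C * wt a b n"
    and small: "C * wt_conv a b a' b' * norm B < 1"
    and u: "\<And>n. u n \<in> fst T" "\<And>n. u (n + 1) = snd (add_bounded T B) (u n)"
    and bd: "\<And>n. norm (u n) \<le> K * wt a' b' n"
  shows "u n = 0"
proof -
  have nn: "0 \<le> C" "0 \<le> K"
    by (rule norm_le_mult_imp_nonneg[OF G[of 0]], simp)
       (rule norm_le_mult_imp_nonneg[OF bd[of 0]], simp)
  define q where "q = C * wt_conv a b a' b' * norm B"
  have q: "0 \<le> q" "q < 1"
    using small nn wt_conv_nonneg by (auto simp: q_def)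
  have rep: "((\<lambda>k. G (n - k) (B (u k))) has_sum u n) UNIV" for n
    by (rule green_representation[OF exps right G u(1) _ bd])
       (simp add: u(2) add_bounded_def)
  have "norm (u n) \<le> (q ^ j * K) * wt a' b' n" for j n
  proof (induction j arbitrary: n)
    case 0
    show ?case using bd by simp
  next
    case (Suc j)
    have "norm (G (n - k) (B (u k))) \<le> (C * norm B * (q ^ j * K)) * (wt a b (n - k) * wt a' b' k)" for k
    proof -
      have "norm (G (n - k) (B (u k))) \<le> norm (G (n - k)) * (norm B * norm (u k))"
        by (meson norm_blinfun order.trans mult_left_mono norm_ge_zero)
      also have "\<dots> \<le> (C * wt a b (n - k)) * (norm B * ((q ^ j * K) * wt a' b' k))"
        using nn q by (intro mult_mono G Suc order.refl) auto
      finally show ?thesis by (simp add: algebra_simps)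
    qed
    from summable_on_kernel(2)[OF exps this] infsumI[OF rep]
    show ?case by (simp add: q_def algebra_simps)
  qed
  moreover have "(\<lambda>j. (q ^ j * K) * wt a' b' n) \<longlonglongrightarrow> (0 * K) * wt a' b' n"
    by (intro tendsto_intros LIMSEQ_power_zero) (use q in auto)
  ultimately have "norm (u n) \<le> 0"
    using LIMSEQ_le_const by fastforce
  then show ?thesis by simp
qed

section \<open>Existence of the perturbed Green kernel\<close>

text \<open>
  Banach's fixed point theorem for families that are bounded in the supremum norm, where the contraction
  property is only required between bounded families: the map below is defined by infinite sums, which
  are meaningful only for these.
\<close>

lemma sup_contraction_fixed_point:
  fixes \<Psi> :: "('i \<Rightarrow> 'b::banach) \<Rightarrow> 'i \<Rightarrow> 'b"
  assumes q: "0 \<le> q" "q < 1"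
    and contr: "\<And>x y R d n. (\<And>k. norm (x k) \<le> R) \<Longrightarrow> (\<And>k. norm (y k) \<le> R) \<Longrightarrow>
      (\<And>k. norm (x k - y k) \<le> d) \<Longrightarrow> norm (\<Psi> x n - \<Psi> y n) \<le> q * d"
    and zero: "\<And>n. norm (\<Psi> (\<lambda>_. 0) n) \<le> C"
  shows "\<exists>v. \<Psi> v = v \<and> (\<forall>n. norm (v n) \<le> C / (1 - q))"
proof -
  define R where "R = C / (1 - q)"
  have "0 \<le> C" using order.trans[OF norm_ge_zero zero] .
  then have R: "0 \<le> R" "q * R + C = R"
    using q by (auto simp: R_def field_simps)
  define v where "v = (\<lambda>j. (\<Psi> ^^ j) (\<lambda>_. 0))"
  have v: "v 0 = (\<lambda>_. 0)" "v (Suc j) = \<Psi> (v j)" for j by (auto simp: v_def)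
  have bd: "norm (v j n) \<le> R" for j n
  proof (induction j arbitrary: n)
    case 0
    show ?case using R by (simp add: v)
  next
    case (Suc j)
    have "norm (\<Psi> (v j) n - \<Psi> (\<lambda>_. 0) n) \<le> q * R"
      by (rule contr[of _ R]) (use Suc R in auto)
    then have "norm (\<Psi> (v j) n) \<le> q * R + C"
      using zero[of n] norm_triangle_sub[of "\<Psi> (v j) n" "\<Psi> (\<lambda>_. 0) n"] by linarith
    then show ?case by (simp add: v R)
  qed
  \<comment> \<open>comparing \<open>\<Psi>^j (v i)\<close> with \<open>\<Psi>^j 0\<close> gives the Cauchy property without a geometric sum\<close>
  have step: "norm (v (j + i) n - v j n) \<le> q ^ j * R" for i j n
  proof (induction j arbitrary: n)
    case 0
    show ?case using bd by (simp add: v)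
  next
    case (Suc j)
    have "norm (\<Psi> (v (j + i)) n - \<Psi> (v j) n) \<le> q * (q ^ j * R)"
      by (rule contr[of _ R]) (use Suc bd in auto)
    then show ?case by (simp add: v mult.assoc)
  qed
  have qR: "(\<lambda>j. q ^ j * R) \<longlonglongrightarrow> 0"
    using tendsto_mult_right[OF LIMSEQ_power_zero[of q], of R] q by simp
  have "Cauchy (\<lambda>j. v j n)" for n
  proof (rule metric_CauchyI)
    fix e :: real assume "0 < e"
    then have "\<forall>\<^sub>F j in sequentially. q ^ j * R < e / 2"
      by (intro order_tendstoD(2)[OF qR]) auto
    then obtain J where J: "q ^ J * R < e / 2" by (auto simp: eventually_sequentially)
    have "dist (v i n) (v J n) < e / 2" if "J \<le> i" for i
      using step[of J "i - J" n] J that by (simp add: dist_norm)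
    then show "\<exists>M. \<forall>i\<ge>M. \<forall>j\<ge>M. dist (v i n) (v j n) < e"
      by (meson dist_triangle_half_l)
  qed
  then have "\<forall>n. \<exists>l. (\<lambda>j. v j n) \<longlonglongrightarrow> l"
    by (simp add: Cauchy_convergent_iff convergent_def)
  then obtain l where l: "\<And>n. (\<lambda>j. v j n) \<longlonglongrightarrow> l n" by metis
  have lR: "norm (l n) \<le> R" for n
    by (rule LIMSEQ_le_const2[OF tendsto_norm[OF l]]) (use bd in auto)
  have close: "norm (l n - v j n) \<le> q ^ j * R" for n j
  proof (rule LIMSEQ_le_const2)
    show "(\<lambda>i. norm (v i n - v j n)) \<longlonglongrightarrow> norm (l n - v j n)"
      by (intro tendsto_intros l)
    show "\<exists>N. \<forall>i\<ge>N. norm (v i n - v j n) \<le> q ^ j * R"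
      using step[of j "_ - j" n] by (metis le_add_diff_inverse)
  qed
  have "\<Psi> l n = l n" for n
  proof -
    have "norm (\<Psi> l n - l n) \<le> 2 * (q ^ Suc j * R)" for j
    proof -
      have "norm (\<Psi> l n - \<Psi> (v j) n) \<le> q * (q ^ j * R)"
        by (rule contr[of _ R]) (use lR bd close in auto)
      moreover have "norm (l n - \<Psi> (v j) n) \<le> q ^ Suc j * R"
        using close[of n "Suc j"] by (simp only: v)
      ultimately show ?thesis
        using norm_triangle_ineq4[of "\<Psi> l n - \<Psi> (v j) n" "l n - \<Psi> (v j) n"] by simp
    qed
    then have "norm (\<Psi> l n - l n) \<le> 2 * 0"
      by (intro LIMSEQ_le_const[OF tendsto_mult_left[OF LIMSEQ_Suc[OF qR]]]) blast
    then show ?thesis by simp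
  qed
  then show ?thesis using lR unfolding R_def by blast
qed

text \<open>
  \<open>H\<close> is the solution of \<open>H = G + G * (B H)\<close>, found as the fixed point of a contraction for the
  rescaled sequence \<open>v = H / wt a' b'\<close>. Applying \<open>T\<close> under the convolution sum, which is possible since
  \<open>T\<close> is closed, produces the extra term \<open>B (H n x)\<close> and so the equation for \<open>T + B\<close>.
\<close>

lemma perturbed_kernel_exists:
  fixes T :: "'a::banach operator"
  assumes exps: "b < b'" "b' < a'" "a' < a"
    and cl: "closed_operator T"
    and left: "green_left T G" and G: "\<And>n. norm (G n) \<le> C * wt a b n"
    and small: "C * wt_conv a b a' b' * norm B \<le> 1 / 2"
    and le: "\<And>n. wt a b n \<le> wt a' b' n"
  shows "\<exists>H. green_left (add_bounded T B) H \<and>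
    (\<forall>n. norm (H n - G n) \<le> 2 * C\<^sup>2 * wt_conv a b a' b' * norm B * wt a' b' n)"
proof -
  have C: "0 \<le> C"
    by (rule norm_le_mult_imp_nonneg[OF G[of 0]]) simp
  define w where "w = wt a' b'"
  define S where "S = wt_conv a b a' b'"
  have w: "0 < w n" for n by (simp add: w_def)
  define q where "q = C * S * norm B"
  have q: "0 \<le> q" "q \<le> 1 / 2"
    using small C wt_conv_nonneg by (auto simp: q_def S_def)
  define \<Phi> where "\<Phi> = (\<lambda>(v :: int \<Rightarrow> 'a \<Rightarrow>\<^sub>L 'a) n k. G (n - k) o\<^sub>L B o\<^sub>L (w k *\<^sub>R v k))"
  have \<Phi>: "norm (\<Phi> v n k) \<le> (C * norm B * d) * (wt a b (n - k) * wt a' b' k)"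
    if "\<And>k. norm (v k) \<le> d" for v d n k
  proof -
    have "norm (\<Phi> v n k) \<le> norm (G (n - k)) * norm B * (w k * norm (v k))"
      unfolding \<Phi>_def using w[of k]
      by (intro order.trans[OF norm_blinfun_compose] mult_mono norm_blinfun_compose) auto
    also have "\<dots> \<le> (C * wt a b (n - k)) * norm B * (w k * d)"
      using that[of k] w[of k] C G[of "n - k"]
      by (intro mult_mono mult_nonneg_nonneg order.refl G that) auto
    finally show ?thesis by (simp add: w_def algebra_simps)
  qed
  \<comment> \<open>the map \<open>H \<mapsto> G + G * (B H)\<close> in the rescaled variable \<open>v = H / w\<close>\<close>
  define \<Psi> where "\<Psi> = (\<lambda>v n. (1 / w n) *\<^sub>R (G n + infsum (\<Phi> v n) UNIV))"
  have \<Phi>_infsum: "norm (infsum (\<Phi> v n) UNIV) \<le> q * d * w n"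
    if "\<And>k. norm (v k) \<le> d" for v d n
    using summable_on_kernel(2)[OF exps \<Phi>[OF that]] by (simp add: q_def S_def w_def algebra_simps)
  have "\<exists>v. \<Psi> v = v \<and> (\<forall>n. norm (v n) \<le> C / (1 - 1 / 2))"
  proof (rule sup_contraction_fixed_point)
    fix x y :: "int \<Rightarrow> 'a \<Rightarrow>\<^sub>L 'a" and R d :: real and n
    assume x: "\<And>k. norm (x k) \<le> R" and y: "\<And>k. norm (y k) \<le> R"
      and d: "\<And>k. norm (x k - y k) \<le> d"
    have "infsum (\<Phi> x n) UNIV - infsum (\<Phi> y n) UNIV = infsum (\<lambda>k. \<Phi> x n k - \<Phi> y n k) UNIV"
      using summable_on_kernel(1)[OF exps \<Phi>[OF x]] summable_on_kernel(1)[OF exps \<Phi>[OF y]]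
      by (intro infsumI[symmetric] has_sum_subtract has_sum_infsum)
    also have "\<dots> = infsum (\<Phi> (\<lambda>k. x k - y k) n) UNIV"
      by (intro infsum_cong)
         (simp add: \<Phi>_def scaleR_diff_right bounded_bilinear.diff_right[OF bounded_bilinear_blinfun_compose])
    finally have "\<Psi> x n - \<Psi> y n = (1 / w n) *\<^sub>R infsum (\<Phi> (\<lambda>k. x k - y k) n) UNIV"
      by (simp add: \<Psi>_def scaleR_diff_right[symmetric])
    then have "norm (\<Psi> x n - \<Psi> y n) \<le> q * d * w n / w n"
      using \<Phi>_infsum[of "\<lambda>k. x k - y k" d n] d w[of n] by (simp add: pos_divide_le_eq)
    also have "\<dots> \<le> 1 / 2 * d"
      using w[of n] mult_right_mono[OF q(2) order.trans[OF norm_ge_zero d]] by simp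
    finally show "norm (\<Psi> x n - \<Psi> y n) \<le> 1 / 2 * d" .
  next
    show "norm (\<Psi> (\<lambda>_. 0) n) \<le> C" for n
      using order.trans[OF G[of n] mult_left_mono[OF le[of n] C]] w[of n]
      by (simp add: \<Psi>_def \<Phi>_def w_def pos_divide_le_eq)
  qed auto
  then obtain v where v: "\<Psi> v = v" and vC: "\<And>n. norm (v n) \<le> 2 * C"
    by (auto simp: mult.commute)
  define H where "H = (\<lambda>n. w n *\<^sub>R v n)"
  have sm: "\<Phi> v n summable_on UNIV" for n
    using summable_on_kernel(1)[OF exps \<Phi>[OF vC]] .
  have \<Phi>H: "\<Phi> v n = (\<lambda>k. G (n - k) o\<^sub>L B o\<^sub>L H k)" for n
    by (simp add: \<Phi>_def H_def)
  have H: "H n - G n = infsum (\<Phi> v n) UNIV" for n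
  proof -
    have "v n = (1 / w n) *\<^sub>R (G n + infsum (\<Phi> v n) UNIV)"
      using fun_cong[OF v, of n] by (simp add: \<Psi>_def)
    then show ?thesis using w[of n] by (simp add: H_def)
  qed
  have sum: "((\<lambda>k. G (n - k) (B (H k x))) has_sum (H n x - G n x)) UNIV" for n x
  proof -
    have "((\<lambda>k. (G (n - k) o\<^sub>L B o\<^sub>L H k) x) has_sum (H n - G n) x) UNIV"
      using sm[of n] unfolding H \<Phi>H by (intro has_sum_bounded_linear[OF blinfun.bounded_linear_left] has_sum_infsum)
    then show ?thesis by (simp add: blinfun.diff_left)
  qed
  have lin: "linear_operator T" using cl by (simp add: closed_operator_def)
  have "green_left (add_bounded T B) H"
    unfolding green_left_def
  proof (intro allI)
    fix n x
    have TG: "snd T (G m y) = G (m + 1) y - (if m = 0 then y else 0)" for m y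
      using left by (simp add: green_left_def)
    have "((\<lambda>k. G (n + 1 - k) (B (H k x)) - (if k = n then B (H n x) else 0)) has_sum
          (H (n + 1) x - G (n + 1) x - B (H n x))) UNIV"
      by (intro has_sum_subtract sum has_sum_delta)
    moreover have "G (n + 1 - k) (B (H k x)) - (if k = n then B (H n x) else 0)
        = snd T (G (n - k) (B (H k x)))" for k
      by (auto simp: TG algebra_simps)
    ultimately have TS: "((\<lambda>k. snd T (G (n - k) (B (H k x)))) has_sum
          (H (n + 1) x - G (n + 1) x - B (H n x))) UNIV"
      by simp
    have dom: "G m y \<in> fst T" for m y using left by (simp add: green_left_def)
    note cs = closed_operator_has_sum[OF cl dom sum TS]
    have "G n x + (H n x - G n x) \<in> fst T"
      by (rule subspace_add[OF linear_operatorD(1)[OF lin] dom cs(1)])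
    moreover have "snd T (G n x + (H n x - G n x))
        = H (n + 1) x - B (H n x) - (if n = 0 then x else 0)"
      unfolding linear_operatorD(2)[OF lin dom cs(1)] cs(2) TG by simp
    ultimately show "H n x \<in> fst (add_bounded T B) \<and>
        H (n + 1) x = snd (add_bounded T B) (H n x) + (if n = 0 then x else 0)"
      by (simp add: add_bounded_def)
  qed
  moreover have "norm (H n - G n) \<le> 2 * C\<^sup>2 * wt_conv a b a' b' * norm B * wt a' b' n" for n
  proof -
    have "norm (H n - G n) \<le> q * (2 * C) * w n"
      unfolding H by (rule \<Phi>_infsum[OF vC])
    then show ?thesis by (simp add: q_def S_def w_def power2_eq_square algebra_simps)
  qed
  ultimately show ?thesis by blast
qed

section \<open>Consequences of uniqueness for one kernel\<close>

text \<open>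
  The part of the perturbation result that the algebra needs: a solution of the left equation in a growth
  class that contains no homogeneous solution except \<open>0\<close>.
\<close>

locale green_kernel =
  fixes T :: "'a::real_normed_vector operator" and G :: "int \<Rightarrow> 'a \<Rightarrow>\<^sub>L 'a" and a b C :: real
  assumes lin: "linear_operator T" and exps: "b \<le> a" and left: "green_left T G"
    and bound: "\<And>n. norm (G n) \<le> C * wt a b n"
    and unique: "\<And>u K n. (\<And>n. u n \<in> fst T) \<Longrightarrow> (\<And>n. u (n + 1) = snd T (u n)) \<Longrightarrow>
      (\<And>n. norm (u n) \<le> K * wt a b n) \<Longrightarrow> u n = 0"
begin

lemmas T_simps = linear_operatorD(2-6)[OF lin]

lemma dom_closed:
  "0 \<in> fst T" "x \<in> fst T \<Longrightarrow> y \<in> fst T \<Longrightarrow> x + y \<in> fst T"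
  "x \<in> fst T \<Longrightarrow> y \<in> fst T \<Longrightarrow> x - y \<in> fst T" "x \<in> fst T \<Longrightarrow> - x \<in> fst T"
  using linear_operatorD(1)[OF lin]
  by (simp_all add: subspace_0 subspace_add subspace_diff subspace_neg)

lemma G_dom [simp]: "G n x \<in> fst T"
  using left by (simp add: green_left_def)

lemma T_G: "snd T (G n x) = G (n + 1) x - (if n = 0 then x else 0)"
  using left by (simp add: green_left_def)

lemma C_nonneg: "0 \<le> C"
  by (rule norm_le_mult_imp_nonneg[OF bound[of 0]]) simp

lemma norm_G: "norm (G n x) \<le> (C * norm x) * wt a b n"
proof -
  have "norm (G n x) \<le> norm (G n) * norm x" by (rule norm_blinfun)
  also have "\<dots> \<le> (C * wt a b n) * norm x" by (intro mult_right_mono bound) auto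
  finally show ?thesis by (simp add: algebra_simps)
qed

lemma solution_eq:
  assumes "\<And>n. u n \<in> fst T" "\<And>n. u (n + 1) = snd T (u n) + (if n = 0 then y else 0)"
    and "\<And>n. norm (u n) \<le> K * wt a b n"
  shows "u n = G n y"
proof -
  have "u n - G n y = 0"
  proof (rule unique)
    show "u m - G m y \<in> fst T" for m
      using assms(1) by (simp add: dom_closed)
    show "u (m + 1) - G (m + 1) y = snd T (u m - G m y)" for m
      using assms(1,2) by (simp add: T_simps T_G)
    show "norm (u m - G m y) \<le> (K + C * norm y) * wt a b m" for m
      using norm_triangle_ineq4[of "u m" "G m y"] assms(3)[of m] norm_G[of m y]
      by (simp add: algebra_simps)
  qed
  then show ?thesis by simp
qed

text \<open>
  The right equation follows from the left one by uniqueness: the difference of its two sides is a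
  homogeneous solution of the same growth.
\<close>

lemma G_T:
  assumes "x \<in> fst T"
  shows "G n (snd T x) = G (n + 1) x - (if n = 0 then x else 0)"
proof -
  define u where "u = (\<lambda>n::int. G n (snd T x) - G (n + 1) x + (if n = 0 then x else 0))"
  have "u n = 0"
  proof (rule unique)
    show "u n \<in> fst T" for n
      using assms by (auto simp: u_def dom_closed)
    show "u (n + 1) = snd T (u n)" for n
      using assms by (auto simp: u_def T_simps T_G dom_closed)
    show "norm (u n) \<le> (C * norm (snd T x) + C * norm x * exp (- b) + norm x) * wt a b n" for n
    proof -
      have "norm (G (n + 1) x) \<le> (C * norm x) * (exp (- b) * wt a b n)"
        using C_nonneg
        by (intro order.trans[OF norm_G] mult_left_mono wt_Suc_le exps) auto
      moreover have "norm (if n = 0 then x else 0) \<le> norm x * wt a b n"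
        by auto
      ultimately show ?thesis
        using norm_G[of n "snd T x"] norm_triangle_ineq4[of "G n (snd T x)" "G (n + 1) x"]
          norm_triangle_ineq[of "G n (snd T x) - G (n + 1) x" "if n = 0 then x else 0"]
        unfolding u_def distrib_right by (simp only: mult.assoc)
    qed
  qed
  then show ?thesis by (simp add: u_def algebra_simps)
qed

text \<open>
  The sequence \<open>G n x\<close> cut off to \<open>n \<ge> 1\<close> jumps from \<open>0\<close> to \<open>G 1 x\<close>, so it is the solution with
  source \<open>G 1 x\<close> at \<open>0\<close>. At \<open>n = 1\<close> this says that \<open>G 1\<close> is a projector.
\<close>

lemma G_G1: "G n (G 1 x) = (if 1 \<le> n then G n x else 0)"
proof (rule solution_eq[symmetric])
  show "(if 1 \<le> m then G m x else 0) \<in> fst T" for m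
    by (simp add: dom_closed)
  show "(if 1 \<le> m + 1 then G (m + 1) x else 0)
      = snd T (if 1 \<le> m then G m x else 0) + (if m = 0 then G 1 x else 0)" for m
    by (auto simp: T_G T_simps)
  show "norm (if 1 \<le> m then G m x else 0) \<le> (C * norm x) * wt a b m" for m
    using norm_G[of m x] C_nonneg by simp
qed

end

section \<open>Parts of an operator in the range of a projector\<close>

lemma part_simps [simp]: "snd (part T Y) = snd T"
  "fst (part T Y) = {x \<in> fst T \<inter> Y. snd T x \<in> Y}"
  by (simp_all add: part_def)

lemma rg_projector_iff:
  assumes "projector P"
  shows "x \<in> rg P \<longleftrightarrow> P x = x"
proof -
  have "P (P y) = P y" for y
    using arg_cong[OF assms[unfolded projector_def], of "\<lambda>Q. blinfun_apply Q y"] by simp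
  then show ?thesis by (auto intro: range_eqI[OF sym])
qed

lemma subspace_rg: "subspace (rg P)"
proof (rule subspaceI)
  show "0 \<in> rg P" by (rule range_eqI[of _ _ 0]) simp
  show "x + y \<in> rg P" if "x \<in> rg P" "y \<in> rg P" for x y
    using that by (auto simp flip: blinfun.add_right)
  show "c *\<^sub>R x \<in> rg P" if "x \<in> rg P" for x c
    using that by (auto simp flip: blinfun.scaleR_right)
qed

lemma linear_operator_subset:
  assumes "linear_operator T" "subspace Y" "Y \<subseteq> fst T"
  shows "linear_operator (Y, snd T)"
  using assms unfolding linear_operator_def fst_conv snd_conv by (meson subsetD)

lemma bounded_operator_on_part:
  fixes T :: "'a::real_normed_vector operator"
  assumes "linear_operator T" "projector Q" "\<And>x. Q x \<in> fst T"
    and "\<And>x. x \<in> fst T \<Longrightarrow> snd T (Q x) = Q (snd T x)" and "\<And>x. snd T (Q x) = blinfun_apply S x"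
  shows "bounded_operator_on (rg Q) (part T (rg Q))"
proof -
  have inv: "snd T (Q x) \<in> rg Q" for x
    using assms(4)[OF assms(3)[of x]] assms(2) by (metis rangeI rg_projector_iff)
  have dom: "fst (part T (rg Q)) = rg Q"
    using assms(3) inv by auto
  then have "part T (rg Q) = (rg Q, snd T)" by (simp add: prod_eq_iff)
  moreover have "linear_operator (rg Q, snd T)"
    using assms(3) by (intro linear_operator_subset assms(1) subspace_rg) auto
  moreover have "norm (snd T x) \<le> norm S * norm x" if "x \<in> rg Q" for x
    using assms(2,5) that norm_blinfun[of S x] by (metis rg_projector_iff)
  ultimately show ?thesis
    unfolding bounded_operator_on_def using inv by auto
qed

text \<open>
  An operator \<open>R\<close> on the whole space that inverts \<open>T\<close> on the range of \<open>Q\<close> and satisfies \<open>Q R = R\<close>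
  replaces the inverse of the part, which is only given through \<^const>\<open>inv_into\<close>.
\<close>

lemma invertible_operator_on_part:
  fixes T :: "'a::real_normed_vector operator" and Q R :: "'a \<Rightarrow>\<^sub>L 'a"
  assumes lin: "linear_operator T" and Q: "projector Q"
    and R: "\<And>x. R x \<in> fst T" "\<And>x. snd T (R x) = Q x" "\<And>x. Q (R x) = R x"
      "\<And>x. x \<in> fst T \<Longrightarrow> R (snd T x) = Q x"
  shows "invertible_operator_on (rg Q) (part T (rg Q))"
    and "y \<in> rg Q \<Longrightarrow> snd (inverse_operator (part T (rg Q))) y = R y"
proof -
  let ?D = "fst (part T (rg Q))"
  have TR: "R y \<in> ?D \<and> snd T (R y) = y" if "y \<in> rg Q" for y
    using R that rg_projector_iff[OF Q] by auto
  have RT: "R (snd T x) = x" if "x \<in> ?D" for x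
    using R that rg_projector_iff[OF Q] by auto
  have inj: "inj_on (snd T) ?D"
    using RT by (metis inj_onI)
  have im: "snd T ` ?D = rg Q"
  proof
    show "rg Q \<subseteq> snd T ` ?D"
      using TR by (metis imageI subsetI)
  qed auto
  have inv: "inv_into ?D (snd T) y = R y" if "y \<in> rg Q" for y
    using TR[OF that] inj by (metis inv_into_f_f)
  have eq: "inverse_operator (part T (rg Q)) = (rg Q, inv_into ?D (snd T))"
    using im by (simp add: inverse_operator_def)
  then show "y \<in> rg Q \<Longrightarrow> snd (inverse_operator (part T (rg Q))) y = R y"
    using inv by simp
  have "linear_operator (rg Q, inv_into ?D (snd T))"
    unfolding linear_operator_def fst_conv snd_conv
  proof (intro conjI ballI allI)
    show sub: "subspace (rg Q)" by (rule subspace_rg)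
    show "inv_into ?D (snd T) (x + y) = inv_into ?D (snd T) x + inv_into ?D (snd T) y"
      if "x \<in> rg Q" "y \<in> rg Q" for x y
      using subspace_add[OF sub that] that by (simp only: inv blinfun.add_right)
    show "inv_into ?D (snd T) (c *\<^sub>R x) = c *\<^sub>R inv_into ?D (snd T) x"
      if "x \<in> rg Q" for x c
      using subspace_scale[OF sub that] that by (simp only: inv blinfun.scaleR_right)
  qed
  moreover have "inv_into ?D (snd T) ` rg Q \<subseteq> rg Q"
    using inv TR by auto
  moreover have "norm (inv_into ?D (snd T) y) \<le> norm R * norm y" if "y \<in> rg Q" for y
    by (simp only: inv[OF that] norm_blinfun)
  ultimately have "bounded_operator_on (rg Q) (inverse_operator (part T (rg Q)))"
    unfolding eq bounded_operator_on_def fst_conv snd_conv by blast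
  then show "invertible_operator_on (rg Q) (part T (rg Q))"
    unfolding invertible_operator_on_def using inj by simp
qed

lemma direct_sum2_rg:
  fixes P Q R :: "'a::real_normed_vector \<Rightarrow>\<^sub>L 'a"
  assumes "\<And>x. blinfun_apply P x + Q x + R x = x" "\<And>x. P (Q x) = 0" "\<And>x. P (R x) = 0"
    "\<And>x. Q (R x) = 0" "projector Q"
  shows "direct_sum2 (rg (id_blinfun - P)) (rg Q) (rg R)"
  unfolding direct_sum2_def
proof
  have "(id_blinfun - P) x = Q x + R x" for x
    using assms(1)[of x] by (simp add: blinfun.diff_left algebra_simps)
  moreover have "Q x + R y \<in> rg (id_blinfun - P)" for x y
    by (rule range_eqI[of _ _ "Q x + R y"])
       (use assms(2,3) in \<open>simp add: blinfun.diff_left blinfun.add_right\<close>)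
  ultimately show "rg (id_blinfun - P) = {u + v |u v. u \<in> rg Q \<and> v \<in> rg R}"
    by (auto simp del: blinfun.diff_left)
  have "x = 0" if "x \<in> rg Q" "x \<in> rg R" for x
    using that assms(4,5) by (auto simp: rg_projector_iff)
  moreover have "0 \<in> rg Q" "0 \<in> rg R"
    by (metis blinfun.zero_right rangeI)+
  ultimately show "rg Q \<inter> rg R = {0}" by blast
qed

text \<open>
  Sufficient conditions in terms of operators on all of \<open>X\<close>: \<open>Ss\<close> and \<open>Sc\<close> witness the boundedness of
  the stable and the centre part, \<open>Rc\<close> and \<open>Ru\<close> the invertibility of the centre and the unstable part.
\<close>

lemma trichotomy_splittingI:
  fixes T :: "'a::real_normed_vector operator" and Qs Qc Qu Ss Sc Rc Ru :: "'a \<Rightarrow>\<^sub>L 'a"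
  assumes lin: "linear_operator T"
    and sum: "\<And>x. Qs x + Qc x + Qu x = x"
    and proj: "projector Qs" "projector Qc" "projector Qu"
    and orth: "\<And>x. Qs (Qc x) = 0" "\<And>x. Qs (Qu x) = 0" "\<And>x. Qc (Qs x) = 0"
      "\<And>x. Qc (Qu x) = 0" "\<And>x. Qu (Qs x) = 0" "\<And>x. Qu (Qc x) = 0"
    and dom: "\<And>x. Qs x \<in> fst T" "\<And>x. Qc x \<in> fst T"
    and comm: "\<And>x. x \<in> fst T \<Longrightarrow> snd T (Qs x) = Qs (snd T x)"
      "\<And>x. x \<in> fst T \<Longrightarrow> snd T (Qc x) = Qc (snd T x)"
      "\<And>x. x \<in> fst T \<Longrightarrow> snd T (Qu x) = Qu (snd T x)"
    and S: "\<And>x. snd T (Qs x) = Ss x" "\<And>x. snd T (Qc x) = Sc x"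
    and Rc: "\<And>x. Rc x \<in> fst T" "\<And>x. snd T (Rc x) = Qc x" "\<And>x. Qc (Rc x) = Rc x"
      "\<And>x. x \<in> fst T \<Longrightarrow> Rc (snd T x) = Qc x"
    and Ru: "\<And>x. Ru x \<in> fst T" "\<And>x. snd T (Ru x) = Qu x" "\<And>x. Qu (Ru x) = Ru x"
      "\<And>x. x \<in> fst T \<Longrightarrow> Ru (snd T x) = Qu x"
  shows "trichotomy_splitting T Qs Qc Qu"
proof -
  note fix_iff = rg_projector_iff[OF proj(1)] rg_projector_iff[OF proj(2)] rg_projector_iff[OF proj(3)]
  have sub: "subspace (fst T)" using linear_operatorD(1)[OF lin] .
  have d3: "u = 0 \<and> v = 0 \<and> w = 0"
    if uvw: "u \<in> rg Qs" "v \<in> rg Qc" "w \<in> rg Qu" and 0: "u + v + w = 0" for u v w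
  proof -
    have e: "Qs u = u" "Qc v = v" "Qu w = w" using uvw fix_iff by auto
    have z: "Qs v = 0" "Qs w = 0" "Qc u = 0" "Qc w = 0" "Qu u = 0" "Qu v = 0"
      using orth e by metis+
    have "u = Qs (u + v + w)" "v = Qc (u + v + w)" "w = Qu (u + v + w)"
      by (simp_all add: blinfun.add_right e z)
    then show ?thesis unfolding 0 by simp
  qed
  have Qu_dom: "Qu x \<in> fst T" if "x \<in> fst T" for x
  proof -
    have "Qu x = x - Qs x - Qc x" using sum[of x] by (simp add: algebra_simps)
    then show ?thesis using sub that dom by (simp add: subspace_diff)
  qed
  have "direct_sum3 UNIV (rg Qs) (rg Qc) (rg Qu)"
    unfolding direct_sum3_def using d3 sum by (auto, metis rangeI)
  moreover have "direct_sum3 (fst T) (rg Qs) (rg Qc) (fst T \<inter> rg Qu)"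
    unfolding direct_sum3_def
  proof (intro conjI)
    show "fst T = {u + v + w |u v w. u \<in> rg Qs \<and> v \<in> rg Qc \<and> w \<in> fst T \<inter> rg Qu}"
      using sum Qu_dom dom sub
      by (auto simp: subspace_add) (metis IntI rangeI)
    show "\<forall>u\<in>rg Qs. \<forall>v\<in>rg Qc. \<forall>w\<in>fst T \<inter> rg Qu. u + v + w = 0 \<longrightarrow> u = 0 \<and> v = 0 \<and> w = 0"
      using d3 by blast
  qed
  moreover have "direct_sum2 (rg (id_blinfun - Qs)) (rg Qc) (rg Qu)"
    "direct_sum2 (rg (id_blinfun - Qc)) (rg Qs) (rg Qu)"
    "direct_sum2 (rg (id_blinfun - Qu)) (rg Qs) (rg Qc)"
    using orth proj sum by (auto intro!: direct_sum2_rg simp: ac_simps)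
  moreover have inv: "snd T ` (fst T \<inter> rg P) \<subseteq> rg P"
    if "projector P" "\<And>x. x \<in> fst T \<Longrightarrow> snd T (P x) = P (snd T x)" for P
    using that(2) rg_projector_iff[OF that(1)] by (metis IntE image_subsetI)
  have "snd T ` (fst T \<inter> rg Qs) \<subseteq> rg Qs" "snd T ` (fst T \<inter> rg Qc) \<subseteq> rg Qc"
    "snd T ` (fst T \<inter> rg Qu) \<subseteq> rg Qu"
    using inv[OF proj(1) comm(1)] inv[OF proj(2) comm(2)] inv[OF proj(3) comm(3)] by auto
  moreover have "bounded_operator_on (rg Qs) (part T (rg Qs))"
    "bounded_operator_on (rg Qc) (part T (rg Qc))"
    by (rule bounded_operator_on_part[OF lin proj(1) dom(1) comm(1) S(1)], assumption)
       (rule bounded_operator_on_part[OF lin proj(2) dom(2) comm(2) S(2)], assumption)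
  moreover have "invertible_operator_on (rg Qc) (part T (rg Qc))"
    "invertible_operator_on (rg Qu) (part T (rg Qu))"
    by (rule invertible_operator_on_part[OF lin proj(2) Rc], assumption)
       (rule invertible_operator_on_part[OF lin proj(3) Ru], assumption)
  ultimately show ?thesis
    unfolding trichotomy_splitting_def using proj by blast
qed

lemma opow_part_int: "opow (part T Y) (int n) = snd T ^^ n"
  by (simp add: opow_def)

lemma opow_part_minus:
  fixes T :: "'a::real_normed_vector operator" and Q R :: "'a \<Rightarrow>\<^sub>L 'a"
  assumes "linear_operator T" "projector Q"
    and "\<And>x. R x \<in> fst T" "\<And>x. snd T (R x) = Q x" "\<And>x. Q (R x) = R x"
      "\<And>x. x \<in> fst T \<Longrightarrow> R (snd T x) = Q x"
    and x: "x \<in> rg Q"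
  shows "opow (part T (rg Q)) (- int n) x = (blinfun_apply R ^^ n) x"
proof -
  note inv = invertible_operator_on_part(2)[OF assms(1-6)]
  have in_rg: "(blinfun_apply R ^^ m) x \<in> rg Q" for m
    by (cases m) (use x assms(5) rg_projector_iff[OF assms(2)] in auto)
  have "(snd (inverse_operator (part T (rg Q))) ^^ m) x = (blinfun_apply R ^^ m) x" for m
  proof (induction m)
    case (Suc m)
    then show ?case using inv[OF _ in_rg[of m]] by simp
  qed simp
  moreover have "opow (part T (rg Q)) (- int n) = snd (inverse_operator (part T (rg Q))) ^^ n"
    by (cases "n = 0") (auto simp: opow_def)
  ultimately show ?thesis by simp
qed

section \<open>Two Green kernels determine a trichotomy\<close>

text \<open>
  \<open>Gs\<close> belongs to the splitting stable against centre-unstable and \<open>Gu\<close> to the splitting centre-stable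
  against unstable; \<open>a\<close> and \<open>b\<close> stand for the exponents \<open>\<rho>\<close> and \<open>\<rho>0\<close> of the trichotomy.
\<close>

locale green_kernel_pair =
  s: green_kernel T Gs a b Cs + u: green_kernel T Gu "- b" "- a" Cu
  for T :: "'a::real_normed_vector operator" and Gs Gu :: "int \<Rightarrow> 'a \<Rightarrow>\<^sub>L 'a" and a b Cs Cu :: real +
  assumes b_pos: "0 < b" and b_less: "b < a"
begin

definition Qs where "Qs = Gs 1"
definition Qu where "Qu = id_blinfun - Gu 1"
definition Qc where "Qc = Gu 1 - Gs 1"

lemmas Q_apply = Qs_def Qu_def Qc_def blinfun.diff_left blinfun.diff_right

text \<open>
  For \<open>n \<ge> 1\<close> the decay rate \<open>e^(-a n)\<close> of \<open>Gs\<close> is stronger than the growth \<open>e^(b n)\<close> that is allowed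
  for \<open>Gu\<close>. Hence the right half of \<open>Gs\<close> also belongs to the growth class of \<open>Gu\<close>, where it is the
  solution with source \<open>Gs 1 x\<close>.
\<close>

lemma Gu_Qs: "Gu n (Gs 1 x) = (if 1 \<le> n then Gs n x else 0)"
proof (rule u.solution_eq[symmetric])
  show "(if 1 \<le> m then Gs m x else 0) \<in> fst T" for m
    by (simp add: s.dom_closed)
  show "(if 1 \<le> m + 1 then Gs (m + 1) x else 0)
      = snd T (if 1 \<le> m then Gs m x else 0) + (if m = 0 then Gs 1 x else 0)" for m
    by (auto simp: s.T_G s.T_simps)
  show "norm (if 1 \<le> m then Gs m x else 0) \<le> (Cs * norm x) * wt (- b) (- a) m" for m
    using order.trans[OF s.norm_G[of m x] mult_left_mono[OF wt_mono[of m "- b" a "- a" b]]]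
      s.C_nonneg b_pos b_less by simp
qed

text \<open>
  The mirror image of \<open>Gu_Qs\<close>: the left half of \<open>Gu\<close> belongs to the growth class of \<open>Gs\<close>. Its jump
  back to \<open>0\<close> at \<open>n = 1\<close> is a source \<open>- T (Gu 0 x) = x - Gu 1 x\<close>.
\<close>

lemma Gs_Qu: "Gs n (x - Gu 1 x) = (if n \<le> 0 then Gu n x else 0)"
proof (rule s.solution_eq[symmetric])
  show "(if m \<le> 0 then Gu m x else 0) \<in> fst T" for m
    by (simp add: s.dom_closed)
  show "(if m + 1 \<le> 0 then Gu (m + 1) x else 0)
      = snd T (if m \<le> 0 then Gu m x else 0) + (if m = 0 then x - Gu 1 x else 0)" for m
    by (auto simp: u.T_G s.T_simps)
  show "norm (if m \<le> 0 then Gu m x else 0) \<le> (Cu * norm x) * wt a b m" for m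
    using order.trans[OF u.norm_G[of m x] mult_left_mono[OF wt_mono_nonpos[of m "- a" a b "- b"]]]
      u.C_nonneg b_pos b_less by simp
qed

lemma Gs_Gu1: "Gs n (Gu 1 x) = Gs n x - (if n \<le> 0 then Gu n x else 0)"
  using Gs_Qu[of n x] by (simp add: blinfun.diff_right algebra_simps)

lemmas G_products = s.G_G1 u.G_G1 Gu_Qs Gs_Gu1

lemma orth:
  "Qs (Qs x) = Qs x" "Qc (Qc x) = Qc x" "Qu (Qu x) = Qu x"
  "Qs (Qc x) = 0" "Qs (Qu x) = 0" "Qc (Qs x) = 0"
  "Qc (Qu x) = 0" "Qu (Qs x) = 0" "Qu (Qc x) = 0"
  by (simp_all add: Q_apply G_products)

text \<open>
  The inverses of \<open>T\<close> on the centre and on the unstable space, extended by \<open>0\<close>. Since the sources of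
  the two kernels cancel, \<open>Gu (n + 1) - Gs (n + 1)\<close> is the group of the powers \<open>T\<^sub>c^n Qc\<close> for all
  integers \<open>n\<close>, and \<open>Rc\<close> is its value at \<open>n = -1\<close>.
\<close>

definition Rc where "Rc = Gu 0 - Gs 0"
definition Ru where "Ru = - Gu 0"

lemma comm:
  assumes "x \<in> fst T"
  shows "snd T (Qs x) = Qs (snd T x)" "snd T (Qc x) = Qc (snd T x)"
    "snd T (Qu x) = Qu (snd T x)"
  using assms by (simp_all add: Q_apply s.T_simps s.T_G u.T_G s.G_T u.G_T)

lemma Rc: "Rc x \<in> fst T" "snd T (Rc x) = Qc x" "Qc (Rc x) = Rc x"
  "x \<in> fst T \<Longrightarrow> Rc (snd T x) = Qc x"
proof -
  show dom: "Rc x \<in> fst T" and T: "snd T (Rc x) = Qc x" for x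
    by (simp_all add: Rc_def Q_apply s.dom_closed s.T_simps s.T_G u.T_G)
  show RT: "x \<in> fst T \<Longrightarrow> Rc (snd T x) = Qc x" for x
    by (simp add: Rc_def Q_apply s.G_T u.G_T)
  have "Rc (Qc x) = Rc x" by (simp add: Rc_def Q_apply G_products)
  then show "Qc (Rc x) = Rc x"
    using RT[OF dom, of x] by (simp add: T)
qed

lemma Ru: "Ru x \<in> fst T" "snd T (Ru x) = Qu x" "Qu (Ru x) = Ru x"
  "x \<in> fst T \<Longrightarrow> Ru (snd T x) = Qu x"
proof -
  show dom: "Ru x \<in> fst T" and T: "snd T (Ru x) = Qu x" for x
    by (simp_all add: Ru_def Q_apply blinfun.minus_left s.dom_closed s.T_simps s.T_G u.T_G)
  show RT: "x \<in> fst T \<Longrightarrow> Ru (snd T x) = Qu x" for x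
    by (simp add: Ru_def Q_apply blinfun.minus_left s.G_T u.G_T)
  have "Ru (Qu x) = Ru x" by (simp add: Ru_def Q_apply blinfun.minus_left G_products)
  then show "Qu (Ru x) = Ru x"
    using RT[OF dom, of x] by (simp add: T)
qed

lemma projectors: "projector Qs" "projector Qc" "projector Qu"
  using orth(1-3) by (auto simp: projector_def intro!: blinfun_eqI)

lemma splitting: "trichotomy_splitting T Qs Qc Qu"
proof (rule trichotomy_splittingI[OF s.lin _ projectors orth(4-9) _ _ comm _ _ Rc Ru])
  show "snd T (Qs x) = Gs 2 x" "snd T (Qc x) = (Gu 2 - Gs 2) x" for x
    by (simp_all add: Q_apply s.T_simps s.T_G u.T_G)
qed (auto simp: Q_apply s.dom_closed)

lemma opow_s: "opow (part T (rg Qs)) (int n) (Qs x) = Gs (int n + 1) x"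
  unfolding opow_part_int by (induction n) (simp_all add: Q_apply s.T_G algebra_simps)

lemma Ru_funpow: "(blinfun_apply Ru ^^ Suc n) x = - Gu (- int n) x"
proof (induction n arbitrary: x)
  case (Suc n)
  have "(blinfun_apply Ru ^^ Suc (Suc n)) x = - Gu (- int n) (Ru x)"
    using Suc[of "Ru x"] by (simp add: funpow_swap1)
  also have "Gu (- int n) (Ru x) = Gu (- int (Suc n)) (snd T (Ru x))"
    using u.G_T[OF Ru(1), of "- int (Suc n)" x] by simp
  also have "\<dots> = Gu (- int (Suc n)) x"
    unfolding Ru(2) by (simp add: Q_apply G_products)
  finally show ?case .
qed (simp add: Ru_def blinfun.minus_left)

lemma opow_u: "opow (part T (rg Qu)) (- int n) (Qu x) = (if n = 0 then x else 0) - Gu (1 - int n) x"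
proof (cases n)
  case 0
  then show ?thesis by (simp add: opow_def Q_apply)
next
  case (Suc m)
  have "opow (part T (rg Qu)) (- int n) (Qu x) = (blinfun_apply Ru ^^ n) (Qu x)"
    using opow_part_minus[OF s.lin projectors(3) Ru] by blast
  also have "\<dots> = - Gu (- int m) x"
    unfolding Suc Ru_funpow by (simp add: Q_apply G_products)
  finally show ?thesis using Suc by simp
qed

lemma Rc_funpow: "(blinfun_apply Rc ^^ n) (Qc x) = Gu (1 - int n) x - Gs (1 - int n) x"
proof (induction n arbitrary: x)
  case 0
  show ?case by (simp add: Q_apply)
next
  case (Suc n)
  have "Rc (Qc x) = Qc (Rc x)" by (simp add: Rc(3)) (simp add: Rc_def Q_apply G_products)
  then have "(blinfun_apply Rc ^^ Suc n) (Qc x) = Gu (1 - int n) (Rc x) - Gs (1 - int n) (Rc x)"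
    using Suc[of "Rc x"] by (simp add: funpow_swap1)
  also have "\<dots> = Gu (- int n) (snd T (Rc x)) - Gs (- int n) (snd T (Rc x))"
    unfolding s.G_T[OF Rc(1)] u.G_T[OF Rc(1)] by simp
  also have "\<dots> = Gu (- int n) x - Gs (- int n) x"
    unfolding Rc(2) by (simp add: Q_apply G_products)
  finally show ?case by simp
qed

lemma opow_c: "opow (part T (rg Qc)) n (Qc x) = Gu (n + 1) x - Gs (n + 1) x"
proof (cases "0 \<le> n")
  case True
  have "opow (part T (rg Qc)) (int m) (Qc x) = Gu (int m + 1) x - Gs (int m + 1) x" for m
    unfolding opow_part_int
  proof (induction m)
    case 0
    show ?case by (simp add: Q_apply)
  next
    case (Suc m)
    then show ?case by (simp add: s.T_G u.T_G s.T_simps ac_simps)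
  qed
  from this[of "nat n"] True show ?thesis by simp
next
  case False
  have "opow (part T (rg Qc)) (- int (nat (- n))) (Qc x) = (blinfun_apply Rc ^^ nat (- n)) (Qc x)"
    using opow_part_minus[OF s.lin projectors(2) Rc] by blast
  then show ?thesis using False by (simp add: Rc_funpow add.commute)
qed

end

section \<open>Norms and powers of operators on a subspace\<close>

lemma bounded_operator_on_funpow:
  assumes "bounded_operator_on Y T"
  shows "bounded_operator_on Y (Y, snd T ^^ n)"
proof (induction n)
  case 0
  have "subspace Y" using assms by (auto simp: bounded_operator_on_def linear_operator_def)
  then show ?case
    by (auto simp: bounded_operator_on_def linear_operator_def intro: exI[of _ 1])
next
  case (Suc n)
  have T: "fst T = Y" "\<And>x. x \<in> Y \<Longrightarrow> snd T x \<in> Y" "linear_operator T"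
    using assms by (auto simp: bounded_operator_on_def)
  obtain K where K: "\<And>x. x \<in> Y \<Longrightarrow> norm (snd T x) \<le> K * norm x"
    using assms by (auto simp: bounded_operator_on_def)
  have P: "\<And>x. x \<in> Y \<Longrightarrow> (snd T ^^ n) x \<in> Y" "linear_operator (Y, snd T ^^ n)"
    using Suc by (auto simp: bounded_operator_on_def)
  obtain L where L: "\<And>x. x \<in> Y \<Longrightarrow> norm ((snd T ^^ n) x) \<le> L * norm x"
    using Suc by (auto simp: bounded_operator_on_def)
  have "norm ((snd T ^^ Suc n) x) \<le> (\<bar>K\<bar> * L) * norm x" if "x \<in> Y" for x
  proof -
    have "norm ((snd T ^^ Suc n) x) \<le> \<bar>K\<bar> * norm ((snd T ^^ n) x)"
      using order.trans[OF K[OF P(1)[OF that]] mult_right_mono[OF abs_ge_self norm_ge_zero]] by simp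
    also have "\<dots> \<le> \<bar>K\<bar> * (L * norm x)"
      by (intro mult_left_mono L that) auto
    finally show ?thesis by simp
  qed
  moreover have "linear_operator (Y, snd T ^^ Suc n)"
    using P T unfolding linear_operator_def by auto
  ultimately show ?case
    using P(1) T(2) unfolding bounded_operator_on_def by auto
qed

lemma bdd_above_onorm_on:
  assumes "bounded_operator_on Y (Y, f)"
  shows "bdd_above ((\<lambda>x. norm (f x) / norm x) ` Y)"
proof -
  obtain K where K: "\<And>x. x \<in> Y \<Longrightarrow> norm (f x) \<le> K * norm x"
    using assms by (auto simp: bounded_operator_on_def)
  have "norm (f y) / norm y \<le> \<bar>K\<bar>" if "y \<in> Y" for y
    using order.trans[OF K[OF that] mult_right_mono[OF abs_ge_self norm_ge_zero]]
    by (cases "y = 0") (auto simp: divide_le_eq)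
  then show ?thesis by (auto intro!: bdd_aboveI2)
qed

text \<open>
  \<^const>\<open>onorm_on\<close> is a supremum of reals, so it yields pointwise bounds only for maps that are known
  to be bounded.
\<close>

lemma norm_le_onorm_on:
  assumes "bounded_operator_on Y (Y, f)" "onorm_on Y f \<le> c" "x \<in> Y"
  shows "norm (f x) \<le> c * norm x"
proof (cases "x = 0")
  case True
  have "f 0 = 0"
    using linear_operatorD(4)[of "(Y, f)"] assms(1) by (simp add: bounded_operator_on_def)
  then show ?thesis using True by simp
next
  case False
  have "norm (f x) / norm x \<le> c"
    using cSUP_upper[OF assms(3) bdd_above_onorm_on[OF assms(1)]] assms(2)
    unfolding onorm_on_def by (rule order.trans)
  then show ?thesis using False by (simp add: divide_le_eq)
qed

lemma onorm_on_le:
  assumes "0 \<in> Y" "0 \<le> c" "\<And>x. x \<in> Y \<Longrightarrow> norm (f x) \<le> c * norm x"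
  shows "onorm_on Y f \<le> c"
  unfolding onorm_on_def
proof (rule cSUP_least)
  show "norm (f x) / norm x \<le> c" if "x \<in> Y" for x
    using assms(2,3) that by (cases "x = 0") (auto simp: divide_le_eq)
qed (use assms(1) in auto)

lemma opow_minus: "opow T (- int n) = snd (inverse_operator T) ^^ n"
  by (cases "n = 0") (auto simp: opow_def)

lemma bounded_operator_on_opow:
  "bounded_operator_on Y T \<Longrightarrow> 0 \<le> n \<Longrightarrow> bounded_operator_on Y (Y, opow T n)"
  "invertible_operator_on Y T \<Longrightarrow> n \<le> 0 \<Longrightarrow> bounded_operator_on Y (Y, opow T n)"
proof -
  show "bounded_operator_on Y T \<Longrightarrow> 0 \<le> n \<Longrightarrow> bounded_operator_on Y (Y, opow T n)"
    using bounded_operator_on_funpow[of Y T "nat n"] by (simp add: opow_def)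
  show "bounded_operator_on Y (Y, opow T n)" if "invertible_operator_on Y T" "n \<le> 0"
    using bounded_operator_on_funpow[of Y "inverse_operator T" "nat (- n)"] that
      opow_minus[of T "nat (- n)"] by (simp add: invertible_operator_on_def)
qed

lemma opow_step_nonneg:
  assumes "0 \<le> n"
  shows "opow T (n + 1) x = snd T (opow T n x)" "opow T (n + 1) x = opow T n (snd T x)"
proof -
  have "opow T (n + 1) = snd T ^^ Suc (nat n)"
    using assms by (simp add: opow_def nat_add_distrib)
  then show "opow T (n + 1) x = snd T (opow T n x)" "opow T (n + 1) x = opow T n (snd T x)"
    using assms by (simp_all add: opow_def funpow_swap1)
qed

lemma opow_step_neg:
  assumes "invertible_operator_on Y T" "n < 0"
  shows "x \<in> Y \<Longrightarrow> opow T n x \<in> fst T" "x \<in> Y \<Longrightarrow> snd T (opow T n x) = opow T (n + 1) x"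
    "x \<in> fst T \<Longrightarrow> opow T n (snd T x) = opow T (n + 1) x"
proof -
  define J where "J = snd (inverse_operator T)"
  have inj: "inj_on (snd T) (fst T)" and im: "snd T ` fst T = Y"
    and inv: "J = inv_into (fst T) (snd T)" and JY: "\<And>x. x \<in> Y \<Longrightarrow> J x \<in> Y"
    using assms(1)
    by (auto simp: invertible_operator_on_def bounded_operator_on_def inverse_operator_def J_def)
  define m where "m = nat (- n - 1)"
  then have m: "n = - int (Suc m)" using assms(2) by simp
  then have n1: "n + 1 = - int m" by simp
  have pow: "(J ^^ k) x \<in> Y" if "x \<in> Y" for k x
    using that by (induction k) (auto intro: JY)
  have e: "opow T n x = J ((J ^^ m) x)" "opow T n x = (J ^^ m) (J x)" for x
    unfolding m opow_minus by (simp_all add: J_def funpow_swap1)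
  have e1: "opow T (n + 1) x = (J ^^ m) x" for x
    unfolding n1 opow_minus J_def ..
  have Jdom: "J y \<in> fst T \<and> snd T (J y) = y" if "y \<in> Y" for y
    using that unfolding inv im[symmetric] by (simp add: inv_into_into f_inv_into_f)
  show "x \<in> Y \<Longrightarrow> opow T n x \<in> fst T" "x \<in> Y \<Longrightarrow> snd T (opow T n x) = opow T (n + 1) x"
    unfolding e(1) e1 using Jdom[OF pow] by auto
  show "x \<in> fst T \<Longrightarrow> opow T n (snd T x) = opow T (n + 1) x"
    unfolding e(2) e1 using inj by (simp add: inv)
qed

text \<open>
  The power \<open>A\<^sub>k^n \<Pi>\<^sub>k\<close> as a bounded operator on the whole space.
\<close>

definition opow_blinfun ::
  "'a::real_normed_vector operator \<Rightarrow> ('a \<Rightarrow>\<^sub>L 'a) \<Rightarrow> int \<Rightarrow> 'a \<Rightarrow>\<^sub>L 'a" where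
  "opow_blinfun A P n = Blinfun (\<lambda>x. opow (part A (rg P)) n (P x))"

lemma opow_blinfun:
  fixes P :: "'a::real_normed_vector \<Rightarrow>\<^sub>L 'a"
  assumes "bounded_operator_on (rg P) (rg P, opow (part A (rg P)) n)"
    and "onorm_on (rg P) (opow (part A (rg P)) n) \<le> c" and "norm P \<le> M"
  shows "opow_blinfun A P n x = opow (part A (rg P)) n (P x)"
    and "0 \<le> c \<Longrightarrow> norm (opow_blinfun A P n) \<le> c * M"
proof -
  let ?f = "opow (part A (rg P)) n"
  have lin: "linear_operator (rg P, ?f)" using assms(1) by (simp add: bounded_operator_on_def)
  have nf: "norm (?f (P x)) \<le> c * norm (P x)" for x
    by (rule norm_le_onorm_on[OF assms(1,2)]) simp
  have "bounded_linear (\<lambda>x. ?f (P x))"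
  proof (rule bounded_linear_intro)
    show "norm (?f (P x)) \<le> norm x * (\<bar>c\<bar> * norm P)" for x
    proof -
      have "norm (?f (P x)) \<le> \<bar>c\<bar> * norm (P x)"
        using nf[of x] mult_right_mono[OF abs_ge_self[of c] norm_ge_zero[of "P x"]] by linarith
      also have "\<dots> \<le> \<bar>c\<bar> * (norm P * norm x)"
        by (intro mult_left_mono norm_blinfun) auto
      finally show ?thesis by (simp add: algebra_simps)
    qed
  qed (use linear_operatorD(2,3)[OF lin] in \<open>simp_all add: blinfun.add_right blinfun.scaleR_right\<close>)
  then show eq: "opow_blinfun A P n x = ?f (P x)" for x
    by (simp add: opow_blinfun_def bounded_linear_Blinfun_apply)
  show "norm (opow_blinfun A P n) \<le> c * M" if "0 \<le> c"
  proof (rule norm_blinfun_bound)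
    show "0 \<le> c * M" using that order.trans[OF norm_ge_zero assms(3)] by simp
    show "norm (opow_blinfun A P n x) \<le> c * M * norm x" for x
    proof -
      have "norm (P x) \<le> M * norm x"
        by (rule order.trans[OF norm_blinfun mult_right_mono[OF assms(3)]]) simp
      then show ?thesis
        using order.trans[OF nf[of x] mult_left_mono[OF _ that]] by (simp add: eq mult.assoc)
    qed
  qed
qed

section \<open>A trichotomy determines two Green kernels\<close>

lemma direct_sum3E:
  assumes "direct_sum3 Z U V W" "x \<in> Z"
  obtains u v w where "x = u + v + w" "u \<in> U" "v \<in> V" "w \<in> W"
  using assms unfolding direct_sum3_def by blast

text \<open>
  \<open>M\<close> bounds the norms of the projectors, which the constant \<open>\<kappa>\<close> of the trichotomy does not control.
\<close>

locale trichotomy_with =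
  fixes A :: "'a::real_normed_vector operator" and \<rho>0 \<rho> \<kappa> M :: real and Ps Pc Pu :: "'a \<Rightarrow>\<^sub>L 'a"
  assumes lin: "linear_operator A"
    and tri: "exponential_trichotomy_with A \<rho>0 \<rho> \<kappa> Ps Pc Pu"
    and M: "norm Ps \<le> M" "norm Pc \<le> M" "norm Pu \<le> M"
begin

lemma exps: "0 < \<rho>0" "\<rho>0 < \<rho>" "1 \<le> \<kappa>"
  using tri by (auto simp: exponential_trichotomy_with_def)

lemma split: "trichotomy_splitting A Ps Pc Pu"
  using tri by (auto simp: exponential_trichotomy_with_def)

lemma projectors: "projector Ps" "projector Pc" "projector Pu"
  using split by (auto simp: trichotomy_splitting_def)

lemmas rg_iff = rg_projector_iff[OF projectors(1)] rg_projector_iff[OF projectors(2)]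
  rg_projector_iff[OF projectors(3)]

lemma idem [simp]: "Ps (Ps x) = Ps x" "Pc (Pc x) = Pc x" "Pu (Pu x) = Pu x"
  using rg_iff by blast+

lemma direct_sum2_orth:
  fixes P Q R :: "'a \<Rightarrow>\<^sub>L 'a"
  assumes "projector P" "direct_sum2 (rg (id_blinfun - P)) (rg Q) (rg R)"
  shows "P (Q x) = 0" "P (R x) = 0"
proof -
  have "P y = 0" if "y \<in> rg (id_blinfun - P)" for y
  proof -
    have "P (P z) = P z" for z using rg_projector_iff[OF assms(1)] by blast
    then show ?thesis using that by (auto simp: blinfun.diff_left blinfun.diff_right)
  qed
  moreover have "0 \<in> rg Q" "0 \<in> rg R" using subspace_0[OF subspace_rg] by auto
  then have "Q x + 0 \<in> rg (id_blinfun - P)" "0 + R x \<in> rg (id_blinfun - P)"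
    using assms(2) unfolding direct_sum2_def by blast+
  ultimately show "P (Q x) = 0" "P (R x) = 0" by auto
qed

lemma orth [simp]:
  "Ps (Pc x) = 0" "Ps (Pu x) = 0" "Pc (Ps x) = 0" "Pc (Pu x) = 0" "Pu (Ps x) = 0" "Pu (Pc x) = 0"
  using split unfolding trichotomy_splitting_def by (blast intro: direct_sum2_orth)+

lemma components:
  assumes "x = u + v + w" "u \<in> rg Ps" "v \<in> rg Pc" "w \<in> rg Pu"
  shows "Ps x = u" "Pc x = v" "Pu x = w"
  using assms(2-4) unfolding assms(1) by (auto simp: blinfun.add_right)

lemma sum: "Ps x + Pc x + Pu x = x"
proof -
  have "direct_sum3 UNIV (rg Ps) (rg Pc) (rg Pu)"
    using split by (simp add: trichotomy_splitting_def)
  then obtain u v w where "x = u + v + w" "u \<in> rg Ps" "v \<in> rg Pc" "w \<in> rg Pu"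
    using direct_sum3E[OF _ UNIV_I] by metis
  then show ?thesis using components[of x u v w] by simp
qed

lemma part_s: "fst (part A (rg Ps)) = rg Ps" and part_c: "fst (part A (rg Pc)) = rg Pc"
  using split unfolding trichotomy_splitting_def bounded_operator_on_def by auto

lemma invariant:
  "x \<in> fst A \<Longrightarrow> Ps x = x \<Longrightarrow> Ps (snd A x) = snd A x"
  "x \<in> fst A \<Longrightarrow> Pc x = x \<Longrightarrow> Pc (snd A x) = snd A x"
  "x \<in> fst A \<Longrightarrow> Pu x = x \<Longrightarrow> Pu (snd A x) = snd A x"
  using split unfolding trichotomy_splitting_def by (auto simp: image_subset_iff rg_iff)

lemma dom: "Ps x \<in> fst A" "Pc x \<in> fst A"
  using part_s part_c by auto

text \<open>
  The projectors commute with \<open>A\<close>: split \<open>x\<close> inside the domain, apply \<open>A\<close> to the three summands, and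
  use that each image stays in its subspace.
\<close>

lemma domain_components:
  assumes "x \<in> fst A"
  shows "Pu x \<in> fst A" "snd A (Ps x) = Ps (snd A x)" "snd A (Pc x) = Pc (snd A x)"
    "snd A (Pu x) = Pu (snd A x)"
proof -
  have "direct_sum3 (fst A) (rg Ps) (rg Pc) (fst A \<inter> rg Pu)"
    using split by (simp add: trichotomy_splitting_def)
  then obtain u v w
    where x: "x = u + v + w" "u \<in> rg Ps" "v \<in> rg Pc" "w \<in> rg Pu" "w \<in> fst A"
    using direct_sum3E[OF _ assms] by (metis IntE)
  note c = components[OF x(1-4)]
  then show u: "Pu x \<in> fst A" using x by simp
  have uv: "u \<in> fst A" "v \<in> fst A" using c dom by metis+
  then have "snd A x = snd A u + snd A v + snd A w"
    using x(1,5) linear_operatorD(1,2)[OF lin] by (simp add: subspace_add)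
  moreover have "snd A u \<in> rg Ps" "snd A v \<in> rg Pc" "snd A w \<in> rg Pu"
    using x uv invariant by (simp_all add: rg_iff)
  ultimately show "snd A (Ps x) = Ps (snd A x)" "snd A (Pc x) = Pc (snd A x)"
    "snd A (Pu x) = Pu (snd A x)"
    using components[of "snd A x" "snd A u" "snd A v" "snd A w"] c by simp_all
qed

text \<open>
  \<open>Es n\<close> is used for \<open>n \<ge> 0\<close> and \<open>Eu n\<close> for \<open>n \<le> 0\<close> only; for other \<open>n\<close> the map in
  \<^const>\<open>opow_blinfun\<close> need not be bounded. \<open>Ec n\<close> makes sense for all integers.
\<close>

definition Es where "Es = opow_blinfun A Ps"
definition Ec where "Ec = opow_blinfun A Pc"
definition Eu where "Eu = opow_blinfun A Pu"

lemma part_bounded: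
  "bounded_operator_on (rg Ps) (part A (rg Ps))" "bounded_operator_on (rg Pc) (part A (rg Pc))"
  "invertible_operator_on (rg Pc) (part A (rg Pc))" "invertible_operator_on (rg Pu) (part A (rg Pu))"
  using split by (auto simp: trichotomy_splitting_def)

lemma growth:
  "onorm_on (rg Pc) (opow (part A (rg Pc)) n) \<le> \<kappa> * exp (\<rho>0 * \<bar>real_of_int n\<bar>)"
  "0 \<le> n \<Longrightarrow> onorm_on (rg Ps) (opow (part A (rg Ps)) n) \<le> \<kappa> * exp (- \<rho> * \<bar>real_of_int n\<bar>)"
  "n \<le> 0 \<Longrightarrow> onorm_on (rg Pu) (opow (part A (rg Pu)) n) \<le> \<kappa> * exp (- \<rho> * \<bar>real_of_int n\<bar>)"
proof -
  have s: "onorm_on (rg Ps) (opow (part A (rg Ps)) (int m)) \<le> \<kappa> * exp (- \<rho> * real m)"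
    and u: "onorm_on (rg Pu) (opow (part A (rg Pu)) (- int m)) \<le> \<kappa> * exp (- \<rho> * real m)" for m
    using tri by (auto simp: exponential_trichotomy_with_def)
  show "0 \<le> n \<Longrightarrow> onorm_on (rg Ps) (opow (part A (rg Ps)) n) \<le> \<kappa> * exp (- \<rho> * \<bar>real_of_int n\<bar>)"
    using s[of "nat n"] by simp
  show "n \<le> 0 \<Longrightarrow> onorm_on (rg Pu) (opow (part A (rg Pu)) n) \<le> \<kappa> * exp (- \<rho> * \<bar>real_of_int n\<bar>)"
    using u[of "nat (- n)"] by simp
  show "onorm_on (rg Pc) (opow (part A (rg Pc)) n) \<le> \<kappa> * exp (\<rho>0 * \<bar>real_of_int n\<bar>)"
    using tri by (auto simp: exponential_trichotomy_with_def)
qed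

lemma bounded_opow:
  "0 \<le> n \<Longrightarrow> bounded_operator_on (rg Ps) (rg Ps, opow (part A (rg Ps)) n)"
  "bounded_operator_on (rg Pc) (rg Pc, opow (part A (rg Pc)) n)"
  "n \<le> 0 \<Longrightarrow> bounded_operator_on (rg Pu) (rg Pu, opow (part A (rg Pu)) n)"
  using bounded_operator_on_opow(1)[OF part_bounded(1)] bounded_operator_on_opow(1)[OF part_bounded(2)]
    bounded_operator_on_opow(2)[OF part_bounded(3)] bounded_operator_on_opow(2)[OF part_bounded(4)]
  by (cases "0 \<le> n"; simp)+

lemma E_apply:
  "0 \<le> n \<Longrightarrow> Es n x = opow (part A (rg Ps)) n (Ps x)"
  "Ec n x = opow (part A (rg Pc)) n (Pc x)"
  "n \<le> 0 \<Longrightarrow> Eu n x = opow (part A (rg Pu)) n (Pu x)"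
  unfolding Es_def Ec_def Eu_def
  by (rule opow_blinfun(1)[OF bounded_opow(1) growth(2) M(1)], assumption+)
     (rule opow_blinfun(1)[OF bounded_opow(2) growth(1) M(2)],
      rule opow_blinfun(1)[OF bounded_opow(3) growth(3) M(3)], assumption+)

lemma E_norm:
  "0 \<le> n \<Longrightarrow> norm (Es n) \<le> \<kappa> * M * exp (- \<rho> * \<bar>real_of_int n\<bar>)"
  "norm (Ec n) \<le> \<kappa> * M * exp (\<rho>0 * \<bar>real_of_int n\<bar>)"
  "n \<le> 0 \<Longrightarrow> norm (Eu n) \<le> \<kappa> * M * exp (- \<rho> * \<bar>real_of_int n\<bar>)"
  using opow_blinfun(2)[OF bounded_opow(1) growth(2) M(1), of n]
    opow_blinfun(2)[OF bounded_opow(2) growth(1) M(2), of n]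
    opow_blinfun(2)[OF bounded_opow(3) growth(3) M(3), of n] exps(3)
  by (simp_all add: Es_def Ec_def Eu_def mult_ac)

lemma E_0: "Es 0 x = Ps x" "Ec 0 x = Pc x" "Eu 0 x = Pu x"
  by (simp_all add: E_apply opow_def)

lemma E_dom: "0 \<le> n \<Longrightarrow> Es n x \<in> fst A" "Ec n x \<in> fst A" "n < 0 \<Longrightarrow> Eu n x \<in> fst A"
proof -
  show "Es n x \<in> fst A" if "0 \<le> n"
  proof -
    have "opow (part A (rg Ps)) n (Ps x) \<in> rg Ps"
      using bounded_opow(1)[OF that] by (auto simp: bounded_operator_on_def)
    then show ?thesis using dom(1) that by (auto simp: E_apply)
  qed
  show "Ec n x \<in> fst A"
  proof -
    have "opow (part A (rg Pc)) n (Pc x) \<in> rg Pc"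
      using bounded_opow(2)[of n] by (auto simp: bounded_operator_on_def)
    then show ?thesis using dom(2) by (auto simp: E_apply)
  qed
  show "Eu n x \<in> fst A" if "n < 0"
    using opow_step_neg(1)[OF part_bounded(4) that, of "Pu x"] that by (simp add: E_apply)
qed

lemma A_E:
  "0 \<le> n \<Longrightarrow> snd A (Es n x) = Es (n + 1) x" "snd A (Ec n x) = Ec (n + 1) x"
  "n < 0 \<Longrightarrow> snd A (Eu n x) = Eu (n + 1) x"
proof -
  show "0 \<le> n \<Longrightarrow> snd A (Es n x) = Es (n + 1) x"
    by (simp add: E_apply opow_step_nonneg(1))
  show "snd A (Ec n x) = Ec (n + 1) x"
    using opow_step_neg(2)[OF part_bounded(3), of n "Pc x"]
    by (cases "0 \<le> n") (simp_all add: E_apply opow_step_nonneg(1))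
  show "n < 0 \<Longrightarrow> snd A (Eu n x) = Eu (n + 1) x"
    using opow_step_neg(2)[OF part_bounded(4), of n "Pu x"] by (simp add: E_apply)
qed

lemma E_A:
  assumes "x \<in> fst A"
  shows "0 \<le> n \<Longrightarrow> Es n (snd A x) = Es (n + 1) x" "Ec n (snd A x) = Ec (n + 1) x"
    "n < 0 \<Longrightarrow> Eu n (snd A x) = Eu (n + 1) x"
proof -
  note c = domain_components(2-4)[OF assms, symmetric]
  show "0 \<le> n \<Longrightarrow> Es n (snd A x) = Es (n + 1) x"
    by (simp add: E_apply c opow_step_nonneg(2))
  have "Pc x \<in> fst (part A (rg Pc))"
    by (simp only: part_c rangeI)
  then show "Ec n (snd A x) = Ec (n + 1) x"
    using opow_step_neg(3)[OF part_bounded(3), of n "Pc x"]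
    by (cases "0 \<le> n") (simp_all add: E_apply c opow_step_nonneg(2))
  have "Pu x \<in> fst (part A (rg Pu))"
    using domain_components(1,4)[OF assms] by simp
  then show "n < 0 \<Longrightarrow> Eu n (snd A x) = Eu (n + 1) x"
    using opow_step_neg(3)[OF part_bounded(4), of n "Pu x"] by (simp add: E_apply c)
qed

text \<open>
  The index is shifted by one so that \<open>Gs 1 = \<Pi>\<^sub>s\<close> and \<open>Gu 1 = I - \<Pi>\<^sub>u\<close>. At \<open>n = 0\<close> the jump from one
  branch to the other produces the identity, because the three projectors add up to it.
\<close>

definition Gs where "Gs n = (if 1 \<le> n then Es (n - 1) else - Ec (n - 1) - Eu (n - 1))"
definition Gu where "Gu n = (if 1 \<le> n then Es (n - 1) + Ec (n - 1) else - Eu (n - 1))"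

lemmas blinfun_left = blinfun.add_left blinfun.minus_left blinfun.diff_left

lemma Gs_left: "green_left A Gs"
  unfolding green_left_def
proof (intro allI conjI)
  note L = linear_operatorD[OF lin]
  fix n x
  have d: "Ec (n - 1) x \<in> fst A" "n \<le> 0 \<Longrightarrow> Eu (n - 1) x \<in> fst A" by (simp_all add: E_dom)
  show "Gs n x \<in> fst A"
    using d L(1) by (auto simp: Gs_def blinfun_left E_dom subspace_neg subspace_add subspace_diff)
  show "Gs (n + 1) x = snd A (Gs n x) + (if n = 0 then x else 0)"
    using d sum[of x] L(1)
    by (auto simp: Gs_def blinfun_left A_E E_0 L subspace_add subspace_neg subspace_diff algebra_simps)
qed

lemma Gu_left: "green_left A Gu"
  unfolding green_left_def
proof (intro allI conjI)
  note L = linear_operatorD[OF lin]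
  fix n x
  have d: "Ec (n - 1) x \<in> fst A" "1 \<le> n \<Longrightarrow> Es (n - 1) x \<in> fst A"
    "n \<le> 0 \<Longrightarrow> Eu (n - 1) x \<in> fst A" by (simp_all add: E_dom)
  show "Gu n x \<in> fst A"
    using d L(1) by (auto simp: Gu_def blinfun_left E_dom subspace_neg subspace_add subspace_diff)
  show "Gu (n + 1) x = snd A (Gu n x) + (if n = 0 then x else 0)"
    using d sum[of x] L(1)
    by (auto simp: Gu_def blinfun_left A_E E_0 L subspace_add subspace_neg subspace_diff algebra_simps)
qed

lemma G_right: "green_right A Gs" "green_right A Gu"
proof -
  have "Gs (n + 1) x = Gs n (snd A x) + (if n = 0 then x else 0) \<and>
      Gu (n + 1) x = Gu n (snd A x) + (if n = 0 then x else 0)" if x: "x \<in> fst A" for n x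
  proof -
    consider "n = 0" | "1 \<le> n" | "n \<le> - 1" by linarith
    then show ?thesis
      using sum[of x]
      by cases (simp_all add: Gs_def Gu_def blinfun_left E_A[OF x] E_0 algebra_simps)
  qed
  then show "green_right A Gs" "green_right A Gu" by (auto simp: green_right_def)
qed

lemma M_nonneg: "0 \<le> M"
  using M(1) norm_ge_zero order.trans by blast

lemma G_norm:
  "norm (Gs n) \<le> 2 * \<kappa> * M * exp \<rho> * wt \<rho> \<rho>0 n"
  "norm (Gu n) \<le> 2 * \<kappa> * M * exp \<rho> * wt (- \<rho>0) (- \<rho>) n"
proof -
  have K: "0 \<le> \<kappa> * M" using exps(3) M_nonneg by simp
  have weaken: "norm E \<le> \<kappa> * M * exp \<rho> * exp d"
    if "norm E \<le> \<kappa> * M * exp c" "c \<le> \<rho> + d" for E :: "'a \<Rightarrow>\<^sub>L 'a" and c d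
  proof -
    have "\<kappa> * M * exp c \<le> \<kappa> * M * exp (\<rho> + d)"
      using that(2) K by (intro mult_left_mono) auto
    then show ?thesis using that(1) by (simp add: exp_add)
  qed
  have double: "norm E \<le> 2 * \<kappa> * M * exp \<rho> * exp d"
    if "norm E \<le> \<kappa> * M * exp \<rho> * exp d" for E :: "'a \<Rightarrow>\<^sub>L 'a" and d
    using order.trans[OF norm_ge_zero that] that by simp
  have add: "norm (E + F) \<le> 2 * \<kappa> * M * exp \<rho> * exp d"
    if "norm E \<le> \<kappa> * M * exp \<rho> * exp d" "norm F \<le> \<kappa> * M * exp \<rho> * exp d"
    for E F :: "'a \<Rightarrow>\<^sub>L 'a" and d
    using norm_triangle_ineq[of E F] that by simp
  show "norm (Gs n) \<le> 2 * \<kappa> * M * exp \<rho> * wt \<rho> \<rho>0 n"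
  proof (cases "1 \<le> n")
    case True
    have "norm (Es (n - 1)) \<le> \<kappa> * M * exp \<rho> * exp (- \<rho> * n)"
      by (rule weaken[OF E_norm(1)]) (use True in \<open>auto simp: algebra_simps\<close>)
    then show ?thesis using True exps double by (simp add: Gs_def wt_of_nonneg)
  next
    case False
    then have n: "real_of_int n \<le> 0" by simp
    have "norm (Ec (n - 1)) \<le> \<kappa> * M * exp \<rho> * exp (- \<rho>0 * n)"
      by (rule weaken[OF E_norm(2)]) (use n exps in \<open>auto simp: algebra_simps\<close>)
    moreover have "norm (Eu (n - 1)) \<le> \<kappa> * M * exp \<rho> * exp (- \<rho>0 * n)"
      by (rule weaken[OF E_norm(3)])
         (use n exps False mult_nonneg_nonpos[of "\<rho> + \<rho>0" n] in \<open>auto simp: algebra_simps\<close>)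
    ultimately show ?thesis
      using False exps add[of "- Ec (n - 1)" _ "- Eu (n - 1)"] by (simp add: Gs_def wt_of_nonpos)
  qed
  show "norm (Gu n) \<le> 2 * \<kappa> * M * exp \<rho> * wt (- \<rho>0) (- \<rho>) n"
  proof (cases "1 \<le> n")
    case True
    have "norm (Es (n - 1)) \<le> \<kappa> * M * exp \<rho> * exp (\<rho>0 * n)"
      by (rule weaken[OF E_norm(1)])
         (use True exps mult_nonneg_nonneg[of "\<rho> + \<rho>0" n] in \<open>auto simp: algebra_simps\<close>)
    moreover have "norm (Ec (n - 1)) \<le> \<kappa> * M * exp \<rho> * exp (\<rho>0 * n)"
      by (rule weaken[OF E_norm(2)]) (use True exps in \<open>auto simp: algebra_simps\<close>)
    ultimately show ?thesis
      using True exps add by (simp add: Gu_def wt_of_nonneg)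
  next
    case False
    have "norm (Eu (n - 1)) \<le> \<kappa> * M * exp \<rho> * exp (\<rho> * n)"
      by (rule weaken[OF E_norm(3)]) (use False exps in \<open>auto simp: algebra_simps\<close>)
    then show ?thesis using False exps double by (simp add: Gu_def wt_of_nonpos)
  qed
qed

end

section \<open>Isomorphic ranges, closedness and the spectral radius\<close>

text \<open>
  The isomorphism is \<open>P\<close> restricted to the range of \<open>Q\<close>. It is bounded below since \<open>x = Q x\<close> differs
  from \<open>P x\<close> by at most \<open>\<parallel>Q - P\<parallel> \<parallel>x\<parallel>\<close>. It is onto since \<open>P Q z = y\<close> is, on the range of \<open>P\<close>,
  the fixed point equation \<open>z = y + P (P - Q) z\<close>.
\<close>

lemma isomorphic_ranges_of_close_projectors:
  fixes P Q :: "'a::banach \<Rightarrow>\<^sub>L 'a"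
  assumes P: "projector P" and Q: "projector Q"
    and close: "norm (Q - P) < 1" "norm P * norm (Q - P) < 1"
  shows "isomorphic_subspaces (rg Q) (rg P)"
proof -
  note iff = rg_projector_iff[OF P] rg_projector_iff[OF Q]
  define e where "e = norm (Q - P)"
  have e: "0 \<le> e" "e < 1" using close by (auto simp: e_def)
  have lower: "(1 - e) * norm x \<le> norm (P x)" if "x \<in> rg Q" for x
  proof -
    have "x - P x = (Q - P) x" using that iff by (simp add: blinfun.diff_left)
    then have "norm (x - P x) \<le> e * norm x" by (simp add: e_def norm_blinfun)
    then show ?thesis using norm_triangle_ineq2[of x "P x"] by (simp add: algebra_simps)
  qed
  have inj: "inj_on P (rg Q)"
  proof (rule inj_onI)
    fix x y assume "x \<in> rg Q" "y \<in> rg Q" "P x = P y"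
    then have "(1 - e) * norm (x - y) \<le> 0"
      using lower[of "x - y"] subspace_diff[OF subspace_rg, of x Q y] by (simp add: blinfun.diff_right)
    then show "x = y" using e by (simp add: mult_le_0_iff)
  qed
  have surj: "y \<in> P ` rg Q" if "y \<in> rg P" for y
  proof -
    have "\<exists>!z. y + P ((P - Q) z) = z"
    proof (rule banach_fix_type)
      show "\<forall>z w. dist (y + P ((P - Q) z)) (y + P ((P - Q) w)) \<le> (norm P * norm (Q - P)) * dist z w"
      proof (intro allI)
        fix z w
        have "dist (y + P ((P - Q) z)) (y + P ((P - Q) w)) = norm (P ((P - Q) (z - w)))"
          by (simp add: dist_norm blinfun.diff_right)
        also have "\<dots> \<le> norm P * (norm (P - Q) * norm (z - w))"
          by (intro order.trans[OF norm_blinfun] mult_left_mono norm_blinfun) auto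
        finally show "dist (y + P ((P - Q) z)) (y + P ((P - Q) w)) \<le> (norm P * norm (Q - P)) * dist z w"
          by (simp add: dist_norm norm_minus_commute mult.assoc)
      qed
    qed (use close in auto)
    then obtain z where z: "y + P ((P - Q) z) = z" by blast
    then have "z \<in> rg P" by (metis subspace_add[OF subspace_rg that] rangeI)
    then have "P (Q z) = y"
      using z iff(1)[of z] iff(1)[of "P z"] by (simp add: blinfun.diff_left blinfun.diff_right algebra_simps)
    then show ?thesis by blast
  qed
  have bij: "bij_betw P (rg Q) (rg P)"
    using inj surj by (auto simp: bij_betw_def)
  have "norm (inv_into (rg Q) P y) \<le> (1 / (1 - e)) * norm y" if "y \<in> rg P" for y
  proof -
    have "(1 - e) * norm (inv_into (rg Q) P y) \<le> norm (P (inv_into (rg Q) P y))"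
      by (intro lower inv_into_into surj that)
    also have "P (inv_into (rg Q) P y) = y" by (intro f_inv_into_f surj that)
    finally show ?thesis using e by (simp add: field_simps)
  qed
  moreover have "linear_operator (rg Q, blinfun_apply P)"
    by (simp add: linear_operator_def subspace_rg blinfun.add_right blinfun.scaleR_right)
  ultimately show ?thesis
    unfolding isomorphic_subspaces_def using bij norm_blinfun[of P] by blast
qed

text \<open>
  The graph of \<open>T + B\<close> is the preimage of the graph of \<open>T\<close> under the continuous map
  \<open>(x, y) \<mapsto> (x, y - B x)\<close>.
\<close>

lemma closed_operator_add_bounded:
  assumes "closed_operator T"
  shows "closed_operator (add_bounded T B)"
proof -
  let ?\<Gamma> = "{(x, snd T x) | x. x \<in> fst T}"
  have lin: "linear_operator T" and cl: "closed ?\<Gamma>"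
    using assms by (auto simp: closed_operator_def)
  have "linear_operator (add_bounded T B)"
    using lin by (simp add: linear_operator_def add_bounded_def blinfun.add_right blinfun.scaleR_right
        scaleR_add_right algebra_simps)
  moreover have "closed ((\<lambda>z. (fst z, snd z - B (fst z))) -` ?\<Gamma>)"
    by (intro closed_vimage cl continuous_intros)
  moreover have "(\<lambda>z. (fst z, snd z - B (fst z))) -` ?\<Gamma>
      = {(x, snd (add_bounded T B) x) | x. x \<in> fst (add_bounded T B)}"
    by (auto simp: add_bounded_def algebra_simps)
  ultimately show ?thesis by (simp add: closed_operator_def)
qed

text \<open>
  Fekete's argument: the limit is the infimum \<open>L\<close> of the roots. If \<open>m\<close> is an index with
  \<open>a m < r^m\<close>, where \<open>r\<close> is slightly larger than \<open>L\<close>, submultiplicativity gives \<open>a n \<le> C r^n\<close> for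
  all \<open>n\<close>, where \<open>C\<close> takes care of the remainders modulo \<open>m\<close>. The convergence has to be proved
  because the spectral radius is defined by \<^const>\<open>lim\<close>.
\<close>

lemma submultiplicative_root_convergent:
  fixes a :: "nat \<Rightarrow> real"
  assumes nonneg: "\<And>n. 0 \<le> a n" and submult: "\<And>m n. a (m + n) \<le> a m * a n"
  shows "convergent (\<lambda>n. root n (a n))"
proof -
  define L where "L = (INF n\<in>{1..}. root n (a n))"
  have bdd: "bdd_below ((\<lambda>n. root n (a n)) ` {1..})"
    using nonneg by (auto intro!: bdd_belowI2[of _ 0] real_root_ge_zero)
  have lower: "L \<le> root n (a n)" if "1 \<le> n" for n
    unfolding L_def by (rule cINF_lower[OF bdd]) (use that in auto)
  have L: "0 \<le> L"
    unfolding L_def by (rule cINF_greatest) (use nonneg in auto)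
  have "\<forall>\<^sub>F n in sequentially. root n (a n) < L + e" if e: "0 < e" for e
  proof -
    define r where "r = L + e / 2"
    have r: "0 < r" "r < L + e" using L e by (auto simp: r_def)
    obtain m where m: "1 \<le> m" "root m (a m) < r"
    proof -
      have "L < r" using e by (simp add: r_def)
      then show ?thesis
        using that cINF_less_iff[OF _ bdd, of r] unfolding L_def[symmetric] by auto
    qed
    have am: "a m \<le> r ^ m"
    proof -
      have "a m = root m (a m) ^ m"
        using m(1) nonneg by (simp add: real_root_pow_pos2)
      also have "\<dots> \<le> r ^ m"
        using m nonneg by (intro power_mono) auto
      finally show ?thesis .
    qed
    define C where "C = 1 + (\<Sum>i<m. a i / r ^ i)"
    have C: "0 < C"
      unfolding C_def using nonneg r by (intro add_pos_nonneg sum_nonneg) auto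
    have bound: "a n \<le> C * r ^ n" for n
    proof (induction n rule: less_induct)
      case (less n)
      show ?case
      proof (cases "n < m")
        case True
        have "a n / r ^ n \<le> (\<Sum>i<m. a i / r ^ i)"
          by (rule member_le_sum) (use True nonneg r in auto)
        then show ?thesis using r by (simp add: C_def divide_le_eq distrib_right add_increasing)
      next
        case False
        have "a n \<le> a m * a (n - m)" using submult[of m "n - m"] False by simp
        also have "\<dots> \<le> r ^ m * (C * r ^ (n - m))"
          using less[of "n - m"] m(1) False am nonneg r C by (intro mult_mono) auto
        also have "\<dots> = C * r ^ n"
          using False by (simp add: power_add[symmetric])
        finally show ?thesis .
      qed
    qed
    have "(\<lambda>n. root n C * r) \<longlonglongrightarrow> 1 * r"
      by (intro tendsto_mult LIMSEQ_root_const C tendsto_const)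
    then have "\<forall>\<^sub>F n in sequentially. root n C * r < L + e"
      using r by (intro order_tendstoD) auto
    then show ?thesis
      using eventually_gt_at_top[of 0]
    proof eventually_elim
      case (elim n)
      have "root n (a n) \<le> root n (C * r ^ n)"
        using elim bound by simp
      also have "\<dots> = root n C * r"
        using elim r by (simp add: real_root_mult real_root_power_cancel)
      finally show ?case using elim by simp
    qed
  qed
  then have "\<forall>\<^sub>F n in sequentially. root n (a n) < c" if "L < c" for c
    using that by (metis add_diff_cancel_left' diff_add_cancel diff_gt_0_iff_gt add.commute)
  moreover have "\<forall>\<^sub>F n in sequentially. c < root n (a n)" if "c < L" for c
    using eventually_ge_at_top[of 1] by eventually_elim (use lower that in force)
  ultimately have "(\<lambda>n. root n (a n)) \<longlonglongrightarrow> L"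
    by (intro order_tendstoI) auto
  then show ?thesis by (auto simp: convergent_def)
qed

lemma onorm_on_nonneg:
  assumes "bounded_operator_on Y (Y, f)"
  shows "0 \<le> onorm_on Y f"
proof -
  have 0: "0 \<in> Y"
    using assms linear_operatorD(1)[of "(Y, f)"] by (auto simp: bounded_operator_on_def subspace_0)
  show ?thesis
    using cSUP_upper[OF 0 bdd_above_onorm_on[OF assms]] by (simp add: onorm_on_def)
qed

lemma spectral_radius_le_exp:
  assumes T: "bounded_operator_on Y T" and \<kappa>: "0 < \<kappa>"
    and growth: "\<And>n. onorm_on Y (opow T (int n)) \<le> \<kappa> * exp (c * real n)"
  shows "spectral_radius Y T \<le> exp c"
proof -
  define a where "a = (\<lambda>n. onorm_on Y (opow T (int n)))"
  have bo: "bounded_operator_on Y (Y, opow T (int n))" for n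
    by (rule bounded_operator_on_opow(1)[OF T]) simp
  have nonneg: "0 \<le> a n" for n
    unfolding a_def by (rule onorm_on_nonneg[OF bo])
  have zero: "0 \<in> Y"
    using T linear_operatorD(1)[of T] by (auto simp: bounded_operator_on_def subspace_0)
  have "a (m + n) \<le> a m * a n" for m n
    unfolding a_def
  proof (rule onorm_on_le[OF zero])
    show "0 \<le> onorm_on Y (opow T (int m)) * onorm_on Y (opow T (int n))"
      using nonneg by (simp add: a_def)
    fix x assume x: "x \<in> Y"
    then have nx: "opow T (int n) x \<in> Y" using bo[of n] by (auto simp: bounded_operator_on_def)
    have "opow T (int (m + n)) x = opow T (int m) (opow T (int n) x)"
      by (simp add: opow_def nat_add_distrib funpow_add)
    also have "norm \<dots> \<le> a m * norm (opow T (int n) x)"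
      unfolding a_def by (rule norm_le_onorm_on[OF bo order.refl nx])
    also have "\<dots> \<le> a m * (a n * norm x)"
      using norm_le_onorm_on[OF bo order.refl x] nonneg by (intro mult_left_mono) (auto simp: a_def)
    finally show "norm (opow T (int (m + n)) x)
        \<le> onorm_on Y (opow T (int m)) * onorm_on Y (opow T (int n)) * norm x"
      by (simp add: a_def mult.assoc)
  qed
  then have "(\<lambda>n. root n (a n)) \<longlonglongrightarrow> spectral_radius Y T"
    using submultiplicative_root_convergent[OF nonneg]
    by (simp add: spectral_radius_def a_def convergent_LIMSEQ_iff)
  moreover have "(\<lambda>n. root n \<kappa> * exp c) \<longlonglongrightarrow> 1 * exp c"
    by (intro tendsto_mult LIMSEQ_root_const \<kappa> tendsto_const)
  moreover have "root n (a n) \<le> root n \<kappa> * exp c" if "1 \<le> n" for n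
  proof -
    have "root n (a n) \<le> root n (\<kappa> * exp c ^ n)"
      using growth[of n] that by (simp add: a_def exp_of_nat_mult[symmetric] mult.commute)
    also have "\<dots> = root n \<kappa> * exp c"
      using that by (simp add: real_root_mult real_root_power_cancel)
    finally show ?thesis .
  qed
  ultimately have "spectral_radius Y T \<le> 1 * exp c"
    by (intro LIMSEQ_le[where X = "\<lambda>n. root n (a n)" and Y = "\<lambda>n. root n \<kappa> * exp c"]) auto
  then show ?thesis by simp
qed

text \<open>
  The exponential estimates bound the spectral radii; \<open>\<alpha> = e^(-\<rho>)\<close> works, as
  \<open>e^\<rho>0 < e^\<rho> = 1 / \<alpha>\<close>.
\<close>

lemma exponential_trichotomy_with_imp:
  fixes A :: "'a::real_normed_vector operator"
  assumes "exponential_trichotomy_with A \<rho>0 \<rho> \<kappa> Ps Pc Pu"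
  shows "exponential_trichotomy A Ps Pc Pu"
proof -
  have e: "0 < \<rho>0" "\<rho>0 < \<rho>" "0 < \<kappa>" and sp: "trichotomy_splitting A Ps Pc Pu"
    and c: "\<And>n::int. onorm_on (rg Pc) (opow (part A (rg Pc)) n) \<le> \<kappa> * exp (\<rho>0 * real_of_int \<bar>n\<bar>)"
    and s: "\<And>n::nat. onorm_on (rg Ps) (opow (part A (rg Ps)) (int n)) \<le> \<kappa> * exp (- \<rho> * real n)"
    and u: "\<And>n::nat. onorm_on (rg Pu) (opow (part A (rg Pu)) (- int n)) \<le> \<kappa> * exp (- \<rho> * real n)"
    using assms by (auto simp: exponential_trichotomy_with_def)
  have inv: "opow (inverse_operator T) (int n) = opow T (- int n)" for T :: "'a operator" and n
    by (simp add: opow_minus) (simp add: opow_def)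
  have b: "bounded_operator_on (rg Ps) (part A (rg Ps))" "bounded_operator_on (rg Pc) (part A (rg Pc))"
    "bounded_operator_on (rg Pc) (inverse_operator (part A (rg Pc)))"
    "bounded_operator_on (rg Pu) (inverse_operator (part A (rg Pu)))"
    using sp by (auto simp: trichotomy_splitting_def invertible_operator_on_def)
  have "spectral_radius (rg Ps) (part A (rg Ps)) \<le> exp (- \<rho>)"
    by (rule spectral_radius_le_exp[OF b(1) e(3) s])
  moreover have "spectral_radius (rg Pu) (inverse_operator (part A (rg Pu))) \<le> exp (- \<rho>)"
    by (rule spectral_radius_le_exp[OF b(4) e(3)]) (use u in \<open>simp add: inv\<close>)
  moreover have "spectral_radius (rg Pc) (part A (rg Pc)) \<le> exp \<rho>0"
    by (rule spectral_radius_le_exp[OF b(2) e(3)]) (use c[of "int _"] in simp)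
  moreover have "spectral_radius (rg Pc) (inverse_operator (part A (rg Pc))) \<le> exp \<rho>0"
    by (rule spectral_radius_le_exp[OF b(3) e(3)]) (use c[of "- int _"] in \<open>simp add: inv\<close>)
  moreover have "exp \<rho>0 < inverse (exp (- \<rho>))" using e by (simp add: exp_minus)
  moreover have "exp (- \<rho>) < 1" using e by simp
  ultimately show ?thesis
    unfolding exponential_trichotomy_def using sp
    by (intro conjI exI[of _ "exp (- \<rho>)"]) auto
qed

section \<open>Perturbation of a trichotomy\<close>

text \<open>
  The passage from the exponents \<open>(a, b)\<close> to \<open>(a', b')\<close> is what makes the convolution converge; the
  perturbed kernel is controlled only in the larger growth class.
\<close>

lemma perturbed_green_kernel:
  fixes T :: "'a::banach operator"
  assumes exps: "b < b'" "b' < a'" "a' < a"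
    and cl: "closed_operator T"
    and G: "green_left T G" "green_right T G" "\<And>n. norm (G n) \<le> C * wt a b n"
    and small: "C * wt_conv a b a' b' * norm B \<le> 1 / 2"
  obtains H C' where "green_kernel (add_bounded T B) H a' b' C'"
    and "\<And>n. norm (H n - G n) \<le> 2 * C\<^sup>2 * wt_conv a b a' b' * norm B * wt a' b' n"
proof -
  have le: "wt a b n \<le> wt a' b' n" for n
    using exps by (cases "0 \<le> n") (auto intro: wt_mono wt_mono_nonpos)
  have C: "0 \<le> C" by (rule norm_le_mult_imp_nonneg[OF G(3)[of 0]]) simp
  define D where "D = 2 * C\<^sup>2 * wt_conv a b a' b' * norm B"
  obtain H where left: "green_left (add_bounded T B) H"
    and diff: "\<And>n. norm (H n - G n) \<le> D * wt a' b' n"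
    using perturbed_kernel_exists[OF exps cl G(1,3) small le] unfolding D_def by blast
  have "green_kernel (add_bounded T B) H a' b' (C + D)"
  proof
    show "linear_operator (add_bounded T B)"
      using closed_operator_add_bounded[OF cl] by (simp add: closed_operator_def)
    show "b' \<le> a'" using exps by simp
    show "norm (H n) \<le> (C + D) * wt a' b' n" for n
      using norm_triangle_sub[of "H n" "G n"] diff[of n] order.trans[OF G(3)[of n] mult_left_mono[OF le[of n] C]]
      by (simp add: distrib_right)
    show "u n = 0" if "\<And>n. u n \<in> fst (add_bounded T B)"
      "\<And>n. u (n + 1) = snd (add_bounded T B) (u n)" "\<And>n. norm (u n) \<le> K * wt a' b' n" for u K n
      by (rule perturbed_uniqueness[OF exps G(2,3) _ _ that(2,3)])
         (use small that(1) in \<open>auto simp: add_bounded_def\<close>)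
  qed (rule left)
  then show thesis using that diff unfolding D_def by blast
qed

context trichotomy_with
begin

lemma G_1: "Gs 1 x = Ps x" "Gu 1 x = Ps x + Pc x"
  by (simp_all add: Gs_def Gu_def E_0 blinfun.add_left)

lemma opow_s: "opow (part A (rg Ps)) (int n) (Ps x) = Gs (int n + 1) x"
  by (simp add: Gs_def E_apply)

lemma opow_u: "opow (part A (rg Pu)) (- int n) (Pu x) = (if n = 0 then x else 0) - Gu (1 - int n) x"
proof (cases "n = 0")
  case True
  then show ?thesis using sum[of x] by (simp add: opow_def G_1 algebra_simps)
next
  case False
  then show ?thesis by (simp add: Gu_def E_apply blinfun.minus_left)
qed

lemma opow_c: "opow (part A (rg Pc)) n (Pc x) = Gu (n + 1) x - Gs (n + 1) x"
  by (simp add: Gs_def Gu_def E_apply(2) blinfun_left)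

end

text \<open>
  The sum over the two kernels, so that a single smallness condition serves both.
\<close>

definition kernel_conv_const :: "real \<Rightarrow> real \<Rightarrow> real \<Rightarrow> real \<Rightarrow> real" where
  "kernel_conv_const \<rho>0 \<rho>0' \<rho>' \<rho> =
     wt_conv \<rho> \<rho>0 \<rho>' \<rho>0' + wt_conv (- \<rho>0) (- \<rho>) (- \<rho>0') (- \<rho>')"

text \<open>
  Bounds for the powers of a part of \<open>A + B\<close> in the norm of its own subspace. A vector \<open>x = Q x\<close> is
  compared with \<open>P x\<close>, whose norm is at most \<open>(1 + \<eta>) \<parallel>x\<parallel>\<close>; hence the constant grows from \<open>\<kappa>\<close> to
  \<open>\<eta> + \<kappa> (1 + \<eta>)\<close> and not by the norm of a projector.
\<close>

lemma perturbed_growth: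
  fixes P Q :: "'a::real_normed_vector \<Rightarrow>\<^sub>L 'a"
  assumes P: "bounded_operator_on (rg P) (rg P, f)" "onorm_on (rg P) f \<le> \<kappa> * w0"
    and Q: "projector Q" and diff: "\<And>x. norm (g (Q x) - f (P x)) \<le> \<eta> * w * norm x"
    and close: "norm (Q - P) \<le> \<eta>" and w: "0 \<le> w0" "w0 \<le> w"
    and \<kappa>: "0 \<le> \<kappa>" "\<eta> + \<kappa> * (1 + \<eta>) \<le> \<kappa>'"
  shows "onorm_on (rg Q) g \<le> \<kappa>' * w"
proof (rule onorm_on_le)
  have \<eta>: "0 \<le> \<eta>" using order.trans[OF norm_ge_zero close] .
  have \<kappa>': "0 \<le> \<kappa>'" using \<kappa> \<eta> by (meson add_nonneg_nonneg mult_nonneg_nonneg order.trans zero_le_one)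
  show "0 \<in> rg Q" by (rule subspace_0[OF subspace_rg])
  show "0 \<le> \<kappa>' * w" using \<kappa>' w by simp
  fix x assume "x \<in> rg Q"
  then have x: "Q x = x" using rg_projector_iff[OF Q] by simp
  have "norm (P x) \<le> (1 + \<eta>) * norm x"
  proof -
    have "norm (P x) \<le> norm (Q x) + norm ((Q - P) x)"
      using norm_triangle_sub[of "P x" "Q x"] by (simp add: blinfun.diff_left norm_minus_commute)
    also have "norm ((Q - P) x) \<le> \<eta> * norm x"
      by (rule order.trans[OF norm_blinfun mult_right_mono[OF close]]) simp
    finally show ?thesis by (simp add: x algebra_simps)
  qed
  then have "norm (f (P x)) \<le> (\<kappa> * w) * ((1 + \<eta>) * norm x)"
    using w \<kappa> by (intro order.trans[OF norm_le_onorm_on[OF P(1,2)]] mult_mono) auto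
  moreover have "norm (g x) \<le> norm (f (P x)) + norm (g (Q x) - f (P x))"
    using norm_triangle_sub[of "g x" "f (P x)"] by (simp add: x)
  ultimately have "norm (g x) \<le> (\<eta> + \<kappa> * (1 + \<eta>)) * (w * norm x)"
    using diff[of x] by (simp add: algebra_simps)
  also have "\<dots> \<le> \<kappa>' * (w * norm x)"
    using \<kappa> w by (intro mult_right_mono) auto
  finally show "norm (g x) \<le> \<kappa>' * w * norm x" by (simp add: mult.assoc)
qed

text \<open>
  The kernels of \<open>A\<close> are bounded by \<open>C\<close> times their weights, so \<open>perturbed_kernel_exists\<close> gives perturbed
  kernels at distance \<open>2 C\<^sup>2 S \<parallel>B\<parallel>\<close>. Every difference in the conclusion is a difference of one or
  two kernels (two for the centre, hence one more factor \<open>2\<close> in \<open>\<eta>\<close>), and \<open>e^\<rho>'\<close> makes up for the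
  index shift between kernels and powers.
\<close>

lemma trichotomy_perturbation:
  fixes A :: "'a::banach operator" and B :: "'a \<Rightarrow>\<^sub>L 'a"
  assumes cl: "closed_operator A"
    and tri: "exponential_trichotomy_with A \<rho>0 \<rho> \<kappa> Ps Pc Pu"
    and M: "norm Ps \<le> M" "norm Pc \<le> M" "norm Pu \<le> M"
    and exps: "\<rho>0 < \<rho>0'" "\<rho>0' < \<rho>'" "\<rho>' < \<rho>"
    and C: "C = 2 * \<kappa> * M * exp \<rho>" and S: "S = kernel_conv_const \<rho>0 \<rho>0' \<rho>' \<rho>"
    and small: "C * S * norm B \<le> 1 / 2"
    and \<eta>: "4 * C\<^sup>2 * S * exp \<rho>' * norm B \<le> \<eta>" "\<eta> + \<kappa> * (1 + \<eta>) \<le> \<kappa>'"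
  obtains Qs Qc Qu where
    "exponential_trichotomy_with (add_bounded A B) \<rho>0' \<rho>' \<kappa>' Qs Qc Qu"
    "norm (Qs - Ps) \<le> \<eta>" "norm (Qc - Pc) \<le> \<eta>" "norm (Qu - Pu) \<le> \<eta>"
    "\<And>n x. norm (opow (part (add_bounded A B) (rg Qs)) (int n) (Qs x) - opow (part A (rg Ps)) (int n) (Ps x))
      \<le> \<eta> * exp (- \<rho>' * real n) * norm x"
    "\<And>n x. norm (opow (part (add_bounded A B) (rg Qu)) (- int n) (Qu x) - opow (part A (rg Pu)) (- int n) (Pu x))
      \<le> \<eta> * exp (- \<rho>' * real n) * norm x"
    "\<And>n x. norm (opow (part (add_bounded A B) (rg Qc)) n (Qc x) - opow (part A (rg Pc)) n (Pc x))
      \<le> \<eta> * exp (\<rho>0' * real_of_int \<bar>n\<bar>) * norm x"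
proof -
  interpret A: trichotomy_with A \<rho>0 \<rho> \<kappa> M Ps Pc Pu
    using cl tri M by unfold_locales (auto simp: closed_operator_def)
  let ?T = "add_bounded A B"
  have \<kappa>: "1 \<le> \<kappa>" and pos: "0 < \<rho>0" using A.exps by auto
  have C0: "0 \<le> C" using \<kappa> A.M_nonneg by (simp add: C)
  define Ss where "Ss = wt_conv \<rho> \<rho>0 \<rho>' \<rho>0'"
  define Su where "Su = wt_conv (- \<rho>0) (- \<rho>) (- \<rho>0') (- \<rho>')"
  have S_le: "Ss \<le> S" "Su \<le> S" "0 \<le> Ss" "0 \<le> Su"
    using wt_conv_nonneg by (auto simp: S kernel_conv_const_def Ss_def Su_def)
  have small': "C * s * norm B \<le> 1 / 2" if "s \<le> S" for s
    by (rule order.trans[OF _ small]) (use that C0 in \<open>intro mult_right_mono mult_left_mono, auto\<close>)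
  define d where "d = 2 * C\<^sup>2 * S * norm B"
  have d_le: "2 * C\<^sup>2 * s * norm B * w \<le> d * w" if "s \<le> S" "0 \<le> w" for s w
    unfolding d_def using that by (intro mult_right_mono mult_left_mono) auto
  have d: "0 \<le> d" using S_le by (simp add: d_def)
  have d\<eta>: "2 * d * exp \<rho>' \<le> \<eta>" using \<eta>(1) by (simp add: d_def mult_ac)
  obtain Hs Cs where Hs: "green_kernel ?T Hs \<rho>' \<rho>0' Cs"
    and Hs_diff: "\<And>n. norm (Hs n - A.Gs n) \<le> 2 * C\<^sup>2 * Ss * norm B * wt \<rho>' \<rho>0' n"
    using perturbed_green_kernel[OF exps cl A.Gs_left A.G_right(1) A.G_norm(1), of B] small'[OF S_le(1)]
    unfolding C Ss_def by blast
  obtain Hu Cu where Hu: "green_kernel ?T Hu (- \<rho>0') (- \<rho>') Cu"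
    and Hu_diff: "\<And>n. norm (Hu n - A.Gu n) \<le> 2 * C\<^sup>2 * Su * norm B * wt (- \<rho>0') (- \<rho>') n"
    using perturbed_green_kernel[of "- \<rho>" "- \<rho>'" "- \<rho>0'" "- \<rho>0" A A.Gu C B, OF _ _ _ cl A.Gu_left A.G_right(2)]
      A.G_norm(2) small'[OF S_le(2)] exps
    unfolding C Su_def by auto
  interpret P: green_kernel_pair ?T Hs Hu \<rho>' \<rho>0' Cs Cu
    using Hs Hu pos exps by (simp add: green_kernel_pair_def green_kernel_pair_axioms_def)
  have Hs_le: "norm (Hs n x - A.Gs n x) \<le> d * wt \<rho>' \<rho>0' n * norm x" for n x
  proof -
    have "norm ((Hs n - A.Gs n) x) \<le> norm (Hs n - A.Gs n) * norm x" by (rule norm_blinfun)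
    also have "\<dots> \<le> d * wt \<rho>' \<rho>0' n * norm x"
      by (intro mult_right_mono order.trans[OF Hs_diff d_le] S_le) auto
    finally show ?thesis by (simp add: blinfun.diff_left)
  qed
  have Hu_le: "norm (Hu n x - A.Gu n x) \<le> d * wt (- \<rho>0') (- \<rho>') n * norm x" for n x
  proof -
    have "norm ((Hu n - A.Gu n) x) \<le> norm (Hu n - A.Gu n) * norm x" by (rule norm_blinfun)
    also have "\<dots> \<le> d * wt (- \<rho>0') (- \<rho>') n * norm x"
      by (intro mult_right_mono order.trans[OF Hu_diff d_le] S_le) auto
    finally show ?thesis by (simp add: blinfun.diff_left)
  qed
  have \<eta>_bound: "d * v * norm x \<le> \<eta> / 2 * exp c * norm x"
    if "v \<le> exp (\<rho>' + c)" for v c and x :: 'a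
  proof -
    have "d * v \<le> d * exp (\<rho>' + c)" using that d by (rule mult_left_mono)
    also have "\<dots> = d * exp \<rho>' * exp c" by (simp add: exp_add)
    also have "\<dots> \<le> \<eta> / 2 * exp c" using d\<eta> by (intro mult_right_mono) auto
    finally show ?thesis by (rule mult_right_mono) simp
  qed
  have \<eta>0: "0 \<le> \<eta>" using d d\<eta> by (meson mult_nonneg_nonneg order.trans exp_ge_zero zero_le_numeral)
  have half: "\<eta> / 2 * exp c * norm x \<le> \<eta> * exp c * norm x" for c and x :: 'a
    using \<eta>0 by (intro mult_right_mono) auto
  have ds: "norm (opow (part ?T (rg P.Qs)) (int n) (P.Qs x) - opow (part A (rg Ps)) (int n) (Ps x))
      \<le> \<eta> * exp (- \<rho>' * real n) * norm x" for n x
  proof -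
    have "wt \<rho>' \<rho>0' (int n + 1) \<le> exp (\<rho>' + - \<rho>' * real n)"
      by (rule order.trans[OF wt_le1]) (use pos exps in \<open>simp add: algebra_simps\<close>)
    from order.trans[OF Hs_le \<eta>_bound[OF this]] show ?thesis
      unfolding P.opow_s A.opow_s using order.trans[OF _ half] by blast
  qed
  have du: "norm (opow (part ?T (rg P.Qu)) (- int n) (P.Qu x) - opow (part A (rg Pu)) (- int n) (Pu x))
      \<le> \<eta> * exp (- \<rho>' * real n) * norm x" for n x
  proof -
    \<comment> \<open>the exponential \<open>e^(\<rho>' m)\<close> bounds the weight at every \<open>m\<close>, so \<open>n = 0\<close>, where \<open>1 - n > 0\<close>, is no
      exception\<close>
    have "wt (- \<rho>0') (- \<rho>') (1 - int n) \<le> exp (\<rho>' + - \<rho>' * real n)"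
      by (rule order.trans[OF wt_le2]) (simp add: algebra_simps)
    from order.trans[OF Hu_le \<eta>_bound[OF this]]
    have "norm (Hu (1 - int n) x - A.Gu (1 - int n) x) \<le> \<eta> * exp (- \<rho>' * real n) * norm x"
      using order.trans[OF _ half] by blast
    then show ?thesis
      unfolding P.opow_u A.opow_u by (simp add: norm_minus_commute)
  qed
  have dc: "norm (opow (part ?T (rg P.Qc)) n (P.Qc x) - opow (part A (rg Pc)) n (Pc x))
      \<le> \<eta> * exp (\<rho>0' * real_of_int \<bar>n\<bar>) * norm x" for n x
  proof -
    have nn: "0 \<le> \<rho>0'" using pos exps by simp
    have r: "\<rho>0' * \<bar>n + 1\<bar> \<le> \<rho>' + \<rho>0' * \<bar>n\<bar>"
    proof -
      have "\<rho>0' * real_of_int \<bar>n + 1\<bar> \<le> \<rho>0' * real_of_int (\<bar>n\<bar> + 1)"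
        using pos exps by (intro mult_left_mono) auto
      then show ?thesis using exps by (simp add: algebra_simps)
    qed
    have "wt \<rho>' \<rho>0' (n + 1) \<le> exp (\<rho>' + \<rho>0' * \<bar>n\<bar>)"
      using r mult_left_mono[OF abs_ge_minus_self[of "real_of_int (n + 1)"] nn]
      by (intro order.trans[OF wt_le2]) (simp add: algebra_simps)
    note 1 = order.trans[OF Hs_le \<eta>_bound[OF this]]
    have "wt (- \<rho>0') (- \<rho>') (n + 1) \<le> exp (\<rho>' + \<rho>0' * \<bar>n\<bar>)"
      using r mult_left_mono[OF abs_ge_self[of "real_of_int (n + 1)"] nn]
      by (intro order.trans[OF wt_le1]) (simp add: algebra_simps)
    note 2 = order.trans[OF Hu_le \<eta>_bound[OF this]]
    have "norm ((Hu (n + 1) x - A.Gu (n + 1) x) - (Hs (n + 1) x - A.Gs (n + 1) x))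
        \<le> \<eta> * exp (\<rho>0' * \<bar>n\<bar>) * norm x"
      by (rule order.trans[OF norm_triangle_ineq4]) (use 1[of x] 2[of x] in simp)
    then show ?thesis
      unfolding P.opow_c A.opow_c by (simp add: algebra_simps)
  qed
  have close: "norm (P.Qs - Ps) \<le> \<eta>" "norm (P.Qc - Pc) \<le> \<eta>" "norm (P.Qu - Pu) \<le> \<eta>"
    using ds[of 0] du[of 0] dc[of 0] \<eta>0
    by (auto intro!: norm_blinfun_bound simp: blinfun.diff_left opow_def)
  have "exponential_trichotomy_with ?T \<rho>0' \<rho>' \<kappa>' P.Qs P.Qc P.Qu"
    unfolding exponential_trichotomy_with_def
  proof (intro conjI allI P.splitting)
    show "0 < \<rho>0'" "\<rho>0' < \<rho>'" using pos exps by auto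
    have "1 * 1 \<le> \<kappa> * (1 + \<eta>)" using \<kappa> \<eta>0 by (intro mult_mono) auto
    then show "1 \<le> \<kappa>'" using \<eta>(2) \<eta>0 by linarith
    fix n :: nat
    show "onorm_on (rg P.Qs) (opow (part ?T (rg P.Qs)) (int n)) \<le> \<kappa>' * exp (- \<rho>' * real n)"
      by (rule perturbed_growth[OF A.bounded_opow(1) A.growth(2) P.projectors(1) ds close(1)])
         (use exps \<kappa> \<eta>(2) in \<open>auto intro: mult_right_mono\<close>)
    show "onorm_on (rg P.Qu) (opow (part ?T (rg P.Qu)) (- int n)) \<le> \<kappa>' * exp (- \<rho>' * real n)"
      by (rule perturbed_growth[OF A.bounded_opow(3) A.growth(3) P.projectors(3) du close(3)])
         (use exps \<kappa> \<eta>(2) in \<open>auto intro: mult_right_mono\<close>)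
  next
    fix n :: int
    show "onorm_on (rg P.Qc) (opow (part ?T (rg P.Qc)) n) \<le> \<kappa>' * exp (\<rho>0' * real_of_int \<bar>n\<bar>)"
      by (rule perturbed_growth[OF A.bounded_opow(2) A.growth(1) P.projectors(2) dc close(2)])
         (use exps \<kappa> \<eta>(2) in \<open>auto intro: mult_right_mono\<close>)
  qed
  from that[OF this close ds du dc] show thesis .
qed

text \<open>
  \<open>trichotomy_perturbation\<close> bounds all differences by \<open>\<eta> = L \<delta>\<close> with \<open>L\<close> depending only on the data
  that are fixed in advance. Since \<open>\<kappa> \<delta> / (\<delta>0 - \<delta>) > \<kappa> \<delta> / \<delta>0\<close>, it is enough that \<open>\<delta>0 L < 1 \<le> \<kappa>\<close>;
  the other conditions on \<open>\<delta>0\<close> are upper bounds too, and \<open>\<delta> < \<delta>0\<^sup>2 / (\<kappa> + \<delta>0)\<close> says precisely that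
  \<open>\<kappa> \<delta> / (\<delta>0 - \<delta>) < \<delta>0\<close>.
\<close>

lemma perturbation_radius_exists:
  fixes \<rho>0 \<rho>0' \<rho>' \<rho> \<kappa> \<kappa>' M :: real
  assumes exps: "0 < \<rho>0" "\<rho>0 < \<rho>0'" "\<rho>0' < \<rho>'" "\<rho>' < \<rho>" and \<kappa>: "\<kappa> < \<kappa>'"
  shows "\<exists>\<delta>0. 0 < \<delta>0 \<and> \<delta>0 < sqrt 2 - 1 \<and>
           (\<forall>(A :: 'a::banach operator) Ps Pc Pu.
              closed_operator A \<longrightarrow> exponential_trichotomy_with A \<rho>0 \<rho> \<kappa> Ps Pc Pu \<longrightarrow>
              norm Ps \<le> M \<longrightarrow> norm Pc \<le> M \<longrightarrow> norm Pu \<le> M \<longrightarrow>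
              (\<forall>\<delta> B. 0 < \<delta> \<longrightarrow> \<delta> < \<delta>0\<^sup>2 / (\<kappa> + \<delta>0) \<longrightarrow> norm B \<le> \<delta> \<longrightarrow>
                 closed_operator (add_bounded A B) \<and>
                 (\<exists>Qs Qc Qu.
                    exponential_trichotomy_with (add_bounded A B) \<rho>0' \<rho>' \<kappa>' Qs Qc Qu \<and>
                    norm (Qs - Ps) < \<kappa> * \<delta> / (\<delta>0 - \<delta>) \<and>
                    norm (Qc - Pc) < \<kappa> * \<delta> / (\<delta>0 - \<delta>) \<and>
                    norm (Qu - Pu) < \<kappa> * \<delta> / (\<delta>0 - \<delta>) \<and>
                    \<kappa> * \<delta> / (\<delta>0 - \<delta>) \<le> \<delta>0 \<and>
                    isomorphic_subspaces (rg Qs) (rg Ps) \<and>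
                    isomorphic_subspaces (rg Qc) (rg Pc) \<and>
                    isomorphic_subspaces (rg Qu) (rg Pu) \<and>
                    (\<forall>n::nat.
                       onorm (\<lambda>x. opow (part (add_bounded A B) (rg Qs)) (int n) (Qs x)
                                   - opow (part A (rg Ps)) (int n) (Ps x))
                         \<le> \<kappa> * \<delta> / (\<delta>0 - \<delta>) * exp (- \<rho>' * real n)) \<and>
                    (\<forall>n::nat.
                       onorm (\<lambda>x. opow (part (add_bounded A B) (rg Qu)) (- int n) (Qu x)
                                   - opow (part A (rg Pu)) (- int n) (Pu x))
                         \<le> \<kappa> * \<delta> / (\<delta>0 - \<delta>) * exp (- \<rho>' * real n)) \<and>
                    (\<forall>n::int.
                       onorm (\<lambda>x. opow (part (add_bounded A B) (rg Qc)) n (Qc x)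
                                   - opow (part A (rg Pc)) n (Pc x))
                         \<le> \<kappa> * \<delta> / (\<delta>0 - \<delta>) * exp (\<rho>0' * real_of_int \<bar>n\<bar>)))))"
    (is "\<exists>\<delta>0. 0 < \<delta>0 \<and> \<delta>0 < _ \<and> (\<forall>A Ps Pc Pu. _ \<longrightarrow> _ \<longrightarrow> _ \<longrightarrow> _ \<longrightarrow> _ \<longrightarrow>
      (\<forall>\<delta> B. _ \<longrightarrow> _ \<longrightarrow> _ \<longrightarrow> _ \<and> (\<exists>Qs Qc Qu. ?conclusion \<delta>0 A Ps Pc Pu \<delta> B Qs Qc Qu)))")
proof (cases "1 \<le> \<kappa> \<and> 0 \<le> M")
  case False
  \<comment> \<open>no trichotomy satisfies the hypotheses, so any admissible number will do\<close>
  have vacuous: False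
    if "exponential_trichotomy_with A \<rho>0 \<rho> \<kappa> Ps Pc Pu" "norm Ps \<le> M" for A :: "'a operator" and Ps Pc Pu
    using that False order.trans[OF norm_ge_zero that(2)]
    by (auto simp: exponential_trichotomy_with_def)
  show ?thesis
  proof (intro exI[of _ "1 / 4"] conjI allI impI)
    show "1 / 4 < sqrt 2 - (1::real)"
      using real_less_rsqrt[of "5 / 4" 2] by (simp add: power2_eq_square)
  qed (simp, (rule FalseE, erule (1) vacuous)+)
next
  case True
  define C where "C = 2 * \<kappa> * M * exp \<rho>"
  define S where "S = kernel_conv_const \<rho>0 \<rho>0' \<rho>' \<rho>"
  define L where "L = 4 * C\<^sup>2 * S * exp \<rho>'"
  define N where "N = 4 + L + 2 * (C * S) + M"
  \<comment> \<open>\<open>N\<close> collects the upper bounds \<open>\<delta>0 \<le> 1 / 4 < sqrt 2 - 1\<close>, \<open>\<delta>0 L < 1\<close>, \<open>C S \<delta>0 \<le> 1 / 2\<close> and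
    \<open>\<delta>0 M < 1\<close> (for the isomorphisms); the other factor ensures
    \<open>\<eta> + \<kappa> (1 + \<eta>) \<le> \<kappa>'\<close>\<close>
  define \<delta>0 where "\<delta>0 = min 1 (\<kappa>' - \<kappa>) / ((1 + \<kappa>) * N)"
  have nn: "0 \<le> C" "0 \<le> S" using True wt_conv_nonneg by (auto simp: C_def S_def kernel_conv_const_def)
  then have nn': "0 \<le> L" "0 \<le> C * S" by (auto simp: L_def)
  then have N: "4 \<le> N" "L + 4 \<le> N" "2 * (C * S) \<le> N" "M \<le> N - 4" using True by (auto simp: N_def)
  have \<delta>0: "0 < \<delta>0" using True \<kappa> N by (auto simp: \<delta>0_def)
  have \<delta>0_N: "\<delta>0 * (1 + \<kappa>) * N = min 1 (\<kappa>' - \<kappa>)"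
    using True N by (simp add: \<delta>0_def)
  have \<delta>0_N1: "\<delta>0 * N \<le> 1"
  proof -
    have "\<delta>0 * N * 1 \<le> \<delta>0 * N * (1 + \<kappa>)" using True \<delta>0 N by (intro mult_left_mono) auto
    then show ?thesis using \<delta>0_N by (simp add: mult_ac)
  qed
  have lt_N: "\<delta>0 * c \<le> 1" if "c \<le> N" for c
    using order.trans[OF mult_left_mono[OF that] \<delta>0_N1] \<delta>0 by simp
  have \<delta>0_L: "\<delta>0 * (1 + \<kappa>) * L \<le> \<kappa>' - \<kappa>"
    using mult_left_mono[of L N "\<delta>0 * (1 + \<kappa>)"] N \<delta>0_N \<delta>0 True by auto
  have quarter: "\<delta>0 \<le> 1 / 4" using lt_N[OF N(1)] by simp
  have sqrt2: "\<delta>0 < sqrt 2 - 1"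
    using real_less_rsqrt[of "5 / 4" 2] quarter by (simp add: power2_eq_square)
  have "\<delta>0 * (M + 4) \<le> 1" "\<delta>0 * (L + 4) \<le> 1"
    by (rule lt_N; use N in simp)+
  then have M1: "\<delta>0 * M < 1" and L1: "\<delta>0 * L < 1"
    using \<delta>0 by (simp_all add: distrib_left)
  show ?thesis
  proof (intro exI[of _ \<delta>0] conjI allI impI \<delta>0 sqrt2)
    fix A :: "'a operator" and Ps Pc Pu B :: "'a \<Rightarrow>\<^sub>L 'a" and \<delta> :: real
    assume cl: "closed_operator A" and tri: "exponential_trichotomy_with A \<rho>0 \<rho> \<kappa> Ps Pc Pu"
      and M: "norm Ps \<le> M" "norm Pc \<le> M" "norm Pu \<le> M"
      and \<delta>: "0 < \<delta>" "\<delta> < \<delta>0\<^sup>2 / (\<kappa> + \<delta>0)" and B: "norm B \<le> \<delta>"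
    let ?\<epsilon> = "\<kappa> * \<delta> / (\<delta>0 - \<delta>)"
    have sq: "\<delta> * (\<kappa> + \<delta>0) < \<delta>0\<^sup>2"
      using \<delta>(2) True \<delta>0 by (simp add: pos_less_divide_eq)
    have "0 \<le> \<delta> * \<kappa>" using \<delta>(1) True by simp
    then have "\<delta> * \<delta>0 < \<delta>0 * \<delta>0"
      using sq by (simp add: power2_eq_square distrib_left)
    then have \<delta>_less: "\<delta> < \<delta>0" using \<delta>0 by simp
    have eps_le: "?\<epsilon> \<le> \<delta>0"
      using sq \<delta>_less by (simp add: pos_divide_le_eq power2_eq_square algebra_simps)
    define \<eta> where "\<eta> = L * \<delta>"
    have \<eta>_less: "\<eta> < ?\<epsilon>"
    proof -
      have "L * (\<delta>0 - \<delta>) \<le> L * \<delta>0" using nn' \<delta> by (intro mult_left_mono) auto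
      also have "\<dots> < \<kappa>" using L1 True by (simp add: mult.commute)
      finally have "\<delta> * (L * (\<delta>0 - \<delta>)) < \<delta> * \<kappa>" using \<delta>(1) by (rule mult_strict_left_mono)
      then show ?thesis using \<delta>_less by (simp add: \<eta>_def pos_less_divide_eq mult_ac)
    qed
    have growth: "\<eta> + \<kappa> * (1 + \<eta>) \<le> \<kappa>'"
    proof -
      have "\<eta> * (1 + \<kappa>) \<le> L * \<delta>0 * (1 + \<kappa>)"
        unfolding \<eta>_def using nn' \<delta>_less True by (intro mult_right_mono mult_left_mono) auto
      then show ?thesis using \<delta>0_L by (simp add: algebra_simps)
    qed
    have small: "C * S * norm B \<le> 1 / 2"
    proof -
      have "C * S * norm B \<le> C * S * \<delta>0" using B \<delta>_less nn' by (intro mult_left_mono) auto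
      then show ?thesis using lt_N[OF N(3)] by (simp add: mult_ac)
    qed
    have LB: "4 * C\<^sup>2 * S * exp \<rho>' * norm B \<le> \<eta>"
      unfolding \<eta>_def L_def[symmetric] using B nn'(1) by (rule mult_left_mono)
    obtain Qs Qc Qu where Q: "exponential_trichotomy_with (add_bounded A B) \<rho>0' \<rho>' \<kappa>' Qs Qc Qu"
      and close: "norm (Qs - Ps) \<le> \<eta>" "norm (Qc - Pc) \<le> \<eta>" "norm (Qu - Pu) \<le> \<eta>"
      and ds: "\<And>n x. norm (opow (part (add_bounded A B) (rg Qs)) (int n) (Qs x) - opow (part A (rg Ps)) (int n) (Ps x))
        \<le> \<eta> * exp (- \<rho>' * real n) * norm x"
      and du: "\<And>n x. norm (opow (part (add_bounded A B) (rg Qu)) (- int n) (Qu x) - opow (part A (rg Pu)) (- int n) (Pu x))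
        \<le> \<eta> * exp (- \<rho>' * real n) * norm x"
      and dc: "\<And>n x. norm (opow (part (add_bounded A B) (rg Qc)) n (Qc x) - opow (part A (rg Pc)) n (Pc x))
        \<le> \<eta> * exp (\<rho>0' * real_of_int \<bar>n\<bar>) * norm x"
      using trichotomy_perturbation[OF cl tri M exps(2-4) C_def S_def small LB growth] by blast
    have \<eta>0: "0 \<le> \<eta>" using order.trans[OF norm_ge_zero close(1)] .
    have onorm: "onorm f \<le> ?\<epsilon> * exp c" if "\<And>x. norm (f x) \<le> \<eta> * exp c * norm x"
      for f :: "'a \<Rightarrow> 'a" and c
    proof -
      have "onorm f \<le> \<eta> * exp c" using \<eta>0 by (intro onorm_bound that) auto
      also have "\<dots> \<le> ?\<epsilon> * exp c" using \<eta>_less by (intro mult_right_mono) auto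
      finally show ?thesis .
    qed
    have iso: "isomorphic_subspaces (rg Q) (rg P)"
      if "projector Q" "projector P" "norm (Q - P) \<le> \<eta>" "norm P \<le> M" for P Q :: "'a \<Rightarrow>\<^sub>L 'a"
    proof (rule isomorphic_ranges_of_close_projectors[OF that(2,1)])
      have c: "norm (Q - P) \<le> \<delta>0" using that(3) \<eta>_less eps_le by linarith
      then show "norm (Q - P) < 1" using quarter by linarith
      have "norm P * norm (Q - P) \<le> M * \<delta>0" using that(4) c True by (intro mult_mono) auto
      then show "norm P * norm (Q - P) < 1" using M1 by (simp add: mult.commute)
    qed
    have proj: "projector Qs" "projector Qc" "projector Qu" "projector Ps" "projector Pc" "projector Pu"
      using Q tri by (auto simp: exponential_trichotomy_with_def trichotomy_splitting_def)
    show "closed_operator (add_bounded A B)" by (rule closed_operator_add_bounded[OF cl])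
    show "\<exists>Qs Qc Qu. ?conclusion \<delta>0 A Ps Pc Pu \<delta> B Qs Qc Qu"
      by (intro exI[of _ Qs] exI[of _ Qc] exI[of _ Qu] conjI allI Q eps_le iso proj close M
          onorm ds du dc order.strict_trans1[OF _ \<eta>_less])
  qed
qed

theorem theorem1p7:
  shows
    "(\<forall>(A :: 'a::banach operator) \<rho>0 \<rho> \<kappa> Ps Pc Pu.
        closed_operator A \<longrightarrow> exponential_trichotomy_with A \<rho>0 \<rho> \<kappa> Ps Pc Pu \<longrightarrow>
        (\<exists>\<epsilon>>0. \<forall>B. norm B \<le> \<epsilon> \<longrightarrow>
           closed_operator (add_bounded A B) \<and>
           (\<exists>Qs Qc Qu. exponential_trichotomy (add_bounded A B) Qs Qc Qu)))
     \<and>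
     (\<forall>\<rho>0 \<rho>0' \<rho>' \<rho> \<kappa> \<kappa>' M :: real.
        0 < \<rho>0 \<longrightarrow> \<rho>0 < \<rho>0' \<longrightarrow> \<rho>0' < \<rho>' \<longrightarrow> \<rho>' < \<rho> \<longrightarrow> \<kappa> < \<kappa>' \<longrightarrow>
        (\<exists>\<delta>0. 0 < \<delta>0 \<and> \<delta>0 < sqrt 2 - 1 \<and>
           (\<forall>(A :: 'a operator) Ps Pc Pu.
              closed_operator A \<longrightarrow> exponential_trichotomy_with A \<rho>0 \<rho> \<kappa> Ps Pc Pu \<longrightarrow>
              norm Ps \<le> M \<longrightarrow> norm Pc \<le> M \<longrightarrow> norm Pu \<le> M \<longrightarrow>
              (\<forall>\<delta> B. 0 < \<delta> \<longrightarrow> \<delta> < \<delta>0\<^sup>2 / (\<kappa> + \<delta>0) \<longrightarrow> norm B \<le> \<delta> \<longrightarrow>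
                 closed_operator (add_bounded A B) \<and>
                 (\<exists>Qs Qc Qu.
                    exponential_trichotomy_with (add_bounded A B) \<rho>0' \<rho>' \<kappa>' Qs Qc Qu \<and>
                    norm (Qs - Ps) < \<kappa> * \<delta> / (\<delta>0 - \<delta>) \<and>
                    norm (Qc - Pc) < \<kappa> * \<delta> / (\<delta>0 - \<delta>) \<and>
                    norm (Qu - Pu) < \<kappa> * \<delta> / (\<delta>0 - \<delta>) \<and>
                    \<kappa> * \<delta> / (\<delta>0 - \<delta>) \<le> \<delta>0 \<and>
                    isomorphic_subspaces (rg Qs) (rg Ps) \<and>
                    isomorphic_subspaces (rg Qc) (rg Pc) \<and>
                    isomorphic_subspaces (rg Qu) (rg Pu) \<and>
                    (\<forall>n::nat.
                       onorm (\<lambda>x. opow (part (add_bounded A B) (rg Qs)) (int n) (Qs x)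
                                   - opow (part A (rg Ps)) (int n) (Ps x))
                         \<le> \<kappa> * \<delta> / (\<delta>0 - \<delta>) * exp (- \<rho>' * real n)) \<and>
                    (\<forall>n::nat.
                       onorm (\<lambda>x. opow (part (add_bounded A B) (rg Qu)) (- int n) (Qu x)
                                   - opow (part A (rg Pu)) (- int n) (Pu x))
                         \<le> \<kappa> * \<delta> / (\<delta>0 - \<delta>) * exp (- \<rho>' * real n)) \<and>
                    (\<forall>n::int.
                       onorm (\<lambda>x. opow (part (add_bounded A B) (rg Qc)) n (Qc x)
                                   - opow (part A (rg Pc)) n (Pc x))
                         \<le> \<kappa> * \<delta> / (\<delta>0 - \<delta>) * exp (\<rho>0' * real_of_int \<bar>n\<bar>)))))))"
proof (intro conjI allI impI)
  fix A :: "'a operator" and \<rho>0 \<rho> \<kappa> :: real and Ps Pc Pu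
  assume cl: "closed_operator A" and tri: "exponential_trichotomy_with A \<rho>0 \<rho> \<kappa> Ps Pc Pu"
  then have e: "0 < \<rho>0" "\<rho>0 < \<rho>" "1 \<le> \<kappa>" by (auto simp: exponential_trichotomy_with_def)
  obtain \<rho>0' where a: "\<rho>0 < \<rho>0'" "\<rho>0' < \<rho>" using dense[OF e(2)] by blast
  obtain \<rho>' where b: "\<rho>0' < \<rho>'" "\<rho>' < \<rho>" using dense[OF a(2)] by blast
  have M: "norm Ps \<le> max (norm Ps) (max (norm Pc) (norm Pu))"
    "norm Pc \<le> max (norm Ps) (max (norm Pc) (norm Pu))"
    "norm Pu \<le> max (norm Ps) (max (norm Pc) (norm Pu))" by auto
  define C where "C = 2 * \<kappa> * max (norm Ps) (max (norm Pc) (norm Pu)) * exp \<rho>"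
  define S where "S = kernel_conv_const \<rho>0 \<rho>0' \<rho>' \<rho>"
  define L where "L = 4 * C\<^sup>2 * S * exp \<rho>'"
  have "0 \<le> C" "0 \<le> S"
    using e wt_conv_nonneg by (auto simp: C_def S_def kernel_conv_const_def le_max_iff_disj)
  then have nn: "0 \<le> L" "0 \<le> C * S" by (auto simp: L_def)
  \<comment> \<open>the constant of the perturbed trichotomy is taken to be \<open>\<kappa> + 1\<close>, which requires
    \<open>\<eta> (1 + \<kappa>) \<le> 1\<close> for \<open>\<eta> = L \<epsilon>\<close>\<close>
  define \<epsilon> where "\<epsilon> = 1 / (1 + 2 * (C * S) + L * (1 + \<kappa>))"
  have "0 \<le> L * (1 + \<kappa>)" using nn e by simp
  then have den: "1 \<le> 1 + 2 * (C * S) + L * (1 + \<kappa>)"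
    and \<epsilon>: "0 < \<epsilon>" "\<epsilon> * (1 + 2 * (C * S) + L * (1 + \<kappa>)) = 1"
    using nn by (simp_all add: \<epsilon>_def)
  have le1: "\<epsilon> * c \<le> 1" if "c \<le> 1 + 2 * (C * S) + L * (1 + \<kappa>)" for c
    using mult_left_mono[OF that, of \<epsilon>] \<epsilon> by simp
  have "\<exists>Qs Qc Qu. exponential_trichotomy (add_bounded A B) Qs Qc Qu" if B: "norm B \<le> \<epsilon>" for B
  proof -
    have "C * S * norm B \<le> C * S * \<epsilon>" using B nn by (intro mult_left_mono) auto
    also have "\<dots> \<le> 1 / 2"
      using le1[of "2 * (C * S)"] nn \<open>0 \<le> L * (1 + \<kappa>)\<close> by (simp add: mult_ac)
    finally have small: "C * S * norm B \<le> 1 / 2" .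
    have LB: "4 * C\<^sup>2 * S * exp \<rho>' * norm B \<le> L * \<epsilon>"
      unfolding L_def[symmetric] using B nn(1) by (rule mult_left_mono)
    have growth: "L * \<epsilon> + \<kappa> * (1 + L * \<epsilon>) \<le> \<kappa> + 1"
      using le1[of "L * (1 + \<kappa>)"] nn by (simp add: algebra_simps)
    show ?thesis
      using trichotomy_perturbation[OF cl tri M a(1) b C_def S_def small LB growth]
        exponential_trichotomy_with_imp by metis
  qed
  then show "\<exists>\<epsilon>>0. \<forall>B. norm B \<le> \<epsilon> \<longrightarrow> closed_operator (add_bounded A B) \<and>
      (\<exists>Qs Qc Qu. exponential_trichotomy (add_bounded A B) Qs Qc Qu)"
    using \<epsilon>(1) closed_operator_add_bounded[OF cl] by blast
qed (rule perturbation_radius_exists)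

end
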